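(* For every integer $n\geq 1$, the group $\Pi_n=\pi_1 Q_n$ is residually nilpotent.
   Context: Let $S^1$ be the circle with a fixed point $\infty\in S^1$, let $T^{n-1}=\{(x_1,\ldots,x_{n-1})\mid x_i\in S^1\}$ be the $(n-1)$-dimensional torus and set $x_n=\infty$. For $1\leq i<j<k\leq n$ let $A_{ijk}\subset T^{n-1}$ be the subset of points satisfying $x_i=x_j=x_k$, and let $A_n=\bigcup_{1\leq i<j<k\leq n}A_{ijk}$. The space $Q_n$ is the complement $T^{n-1}\setminus A_n$. The round twin group on $n$ strands is $\Pi_n=\pi_1 Q_n$. A group is residually nilpotent if the intersection of all terms of its lower central series is trivial. *)

theory Defs
  imports "HOL-Analysis.Analysis" "HOL-Algebra.Generated_Groups"
begin

section \<open>The fundamental group\<close>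

definition loops_at :: "'a::topological_space set \<Rightarrow> 'a \<Rightarrow> (real \<Rightarrow> 'a) set" where
  "loops_at S x = {p. path p \<and> path_image p \<subseteq> S \<and> pathstart p = x \<and> pathfinish p = x}"

definition path_class :: "'a::topological_space set \<Rightarrow> (real \<Rightarrow> 'a) \<Rightarrow> (real \<Rightarrow> 'a) set" where
  "path_class S p = {q. homotopic_paths S p q}"

text \<open>
  The product is written as a union over all representatives, so that no choice is needed;
  \<open>fundamental_group_mult\<close> below shows that it is the class of the concatenation of any two
  representatives. The unit is the class of the constant path (\<open>linepath\<close> is not available on
  a general topological space).
\<close>

definition fundamental_group :: "'a::topological_space set \<Rightarrow> 'a \<Rightarrow> (real \<Rightarrow> 'a) set monoid" where
  "fundamental_group S x =
     \<lparr>carrier = path_class S ` loops_at S x,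
      mult = (\<lambda>A B. \<Union>p\<in>A. \<Union>q\<in>B. path_class S (p +++ q)),
      one = path_class S (\<lambda>_. x)\<rparr>"

lemma path_class_eqI: "homotopic_paths S p q \<Longrightarrow> path_class S p = path_class S q"
  unfolding path_class_def using homotopic_paths_sym homotopic_paths_trans by blast

lemma path_class_self: "p \<in> loops_at S x \<Longrightarrow> p \<in> path_class S p"
  by (simp add: path_class_def loops_at_def)

lemma loops_at_join: "p \<in> loops_at S x \<Longrightarrow> q \<in> loops_at S x \<Longrightarrow> p +++ q \<in> loops_at S x"
  by (auto simp: loops_at_def subset_path_image_join)

lemma loops_at_reversepath: "p \<in> loops_at S x \<Longrightarrow> reversepath p \<in> loops_at S x"
  by (simp add: loops_at_def)

lemma loops_at_const: "x \<in> S \<Longrightarrow> (\<lambda>_. x) \<in> loops_at S x"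
  by (auto simp: loops_at_def path_def path_image_def pathstart_def pathfinish_def)

lemma fundamental_group_mult:
  assumes "p \<in> loops_at S x" "q \<in> loops_at S x"
  shows "path_class S p \<otimes>\<^bsub>fundamental_group S x\<^esub> path_class S q = path_class S (p +++ q)"
proof -
  have "path_class S (p' +++ q') = path_class S (p +++ q)"
    if "p' \<in> path_class S p" "q' \<in> path_class S q" for p' q'
  proof -
    have "homotopic_paths S (p +++ q) (p' +++ q')"
      using that assms by (intro homotopic_paths_join) (auto simp: path_class_def loops_at_def)
    then show ?thesis
      using path_class_eqI by metis
  qed
  then have "(\<Union>p'\<in>path_class S p. \<Union>q'\<in>path_class S q. path_class S (p' +++ q')) =
      (\<Union>p'\<in>path_class S p. \<Union>q'\<in>path_class S q. path_class S (p +++ q))"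
    by (intro SUP_cong refl)
  also have "\<dots> = path_class S (p +++ q)"
    using path_class_self[OF assms(1)] path_class_self[OF assms(2)] by blast
  finally show ?thesis
    by (simp add: fundamental_group_def)
qed

lemma homotopic_paths_const_left:
  assumes "p \<in> loops_at S x"
  shows "homotopic_paths S ((\<lambda>_. x) +++ p) p"
proof (rule homotopic_paths_sym, rule homotopic_paths_reparametrize
    [where f = "\<lambda>t. if t \<le> 1/2 then 0 else 2 * t - 1"])
  show "continuous_on {0..1} (\<lambda>t::real. if t \<le> 1/2 then 0 else 2 * t - 1)"
    unfolding split_01 by (rule continuous_on_cases continuous_intros | force)+
qed (use assms in \<open>auto simp: loops_at_def joinpaths_def pathstart_def\<close>)

lemma homotopic_paths_reversepath_const:
  assumes "p \<in> loops_at S x"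
  shows "homotopic_paths S (reversepath p +++ p) (\<lambda>_. x)"
proof -
  define r where "r = reversepath p"
  have r: "path r" "path_image r \<subseteq> S" "r 0 = x" "r 1 = x"
    using loops_at_reversepath[OF assms]
    by (auto simp: loops_at_def r_def pathstart_def pathfinish_def)
  have cr: "continuous_on {0..1} r"
    using r(1) by (simp add: path_def)
  have rS: "r t \<in> S" if "0 \<le> t" "t \<le> 1" for t
    using r(2) that by (auto simp: path_image_def)
  let ?A = "{0..1} \<times> {0..1::real}"
  define g :: "real \<Rightarrow> real" where "g = (\<lambda>t. if t \<le> 1/2 then 2 * t else 2 - 2 * t)"
  have g: "g 0 = 0" "g 1 = 0" "\<And>t. t \<le> 1/2 \<Longrightarrow> g t = 2 * t" "\<And>t. \<not> t \<le> 1/2 \<Longrightarrow> g t = 2 - 2 * t"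
    by (auto simp: g_def)
  have "0 \<le> g t" "g t \<le> 1" if "0 \<le> t" "t \<le> 1" for t
    using that by (auto simp: g_def)
  then have bounds: "0 \<le> a * g t" "a * g t \<le> 1" if "0 \<le> a" "a \<le> 1" "0 \<le> t" "t \<le> 1" for a t
    using that by (auto intro: mult_le_one)
  have "continuous_on ?A (\<lambda>y. g (snd y))"
    unfolding g_def by (rule continuous_on_cases_le) (auto intro!: continuous_intros)
  then have "continuous_on ?A (\<lambda>y. r (fst y * g (snd y)))"
    using bounds by (intro continuous_on_compose2[OF cr] continuous_intros) auto
  moreover have "reversepath r (2 * t - 1) = r (2 - 2 * t)" for t
    by (simp add: reversepath_def)
  ultimately have "homotopic_paths S (\<lambda>_. x) (r +++ reversepath r)"
    using bounds rS r g unfolding homotopic_paths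
    by (intro exI[of _ "\<lambda>y. r (fst y * g (snd y))"])
       (auto simp: joinpaths_def pathstart_def pathfinish_def)
  then show ?thesis
    by (simp add: r_def homotopic_paths_sym)
qed

lemma group_fundamental_group:
  assumes "x \<in> S"
  shows "group (fundamental_group S x)"
proof (rule groupI)
  let ?G = "fundamental_group S x"
  have carrier: "carrier ?G = path_class S ` loops_at S x" and one: "\<one>\<^bsub>?G\<^esub> = path_class S (\<lambda>_. x)"
    by (simp_all add: fundamental_group_def)
  show "\<one>\<^bsub>?G\<^esub> \<in> carrier ?G"
    using assms by (auto simp: carrier one loops_at_const)
  show "A \<otimes>\<^bsub>?G\<^esub> B \<in> carrier ?G" if "A \<in> carrier ?G" "B \<in> carrier ?G" for A B
    using that by (auto simp: carrier fundamental_group_mult loops_at_join)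
  show "A \<otimes>\<^bsub>?G\<^esub> B \<otimes>\<^bsub>?G\<^esub> C = A \<otimes>\<^bsub>?G\<^esub> (B \<otimes>\<^bsub>?G\<^esub> C)"
    if ABC: "A \<in> carrier ?G" "B \<in> carrier ?G" "C \<in> carrier ?G" for A B C
  proof -
    obtain p q r where pqr: "p \<in> loops_at S x" "q \<in> loops_at S x" "r \<in> loops_at S x"
      and [simp]: "A = path_class S p" "B = path_class S q" "C = path_class S r"
      using ABC unfolding carrier by blast
    have "homotopic_paths S (p +++ (q +++ r)) ((p +++ q) +++ r)"
      using pqr by (intro homotopic_paths_assoc) (auto simp: loops_at_def)
    with pqr show ?thesis
      by (simp add: fundamental_group_mult loops_at_join path_class_eqI)
  qed
  show "\<one>\<^bsub>?G\<^esub> \<otimes>\<^bsub>?G\<^esub> A = A" if A: "A \<in> carrier ?G" for A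
  proof -
    obtain p where p: "p \<in> loops_at S x" and [simp]: "A = path_class S p"
      using A by (auto simp: carrier)
    show ?thesis
      using fundamental_group_mult[OF loops_at_const[OF assms] p]
        path_class_eqI[OF homotopic_paths_const_left[OF p]]
      by (simp add: one)
  qed
  show "\<exists>B\<in>carrier ?G. B \<otimes>\<^bsub>?G\<^esub> A = \<one>\<^bsub>?G\<^esub>" if A: "A \<in> carrier ?G" for A
  proof -
    obtain p where p: "p \<in> loops_at S x" and [simp]: "A = path_class S p"
      using A by (auto simp: carrier)
    show ?thesis
      using p loops_at_reversepath[OF p] path_class_eqI[OF homotopic_paths_reversepath_const[OF p]]
      by (intro bexI[of _ "path_class S (reversepath p)"])
         (auto simp: carrier one fundamental_group_mult)
  qed
qed


section \<open>Residual nilpotence\<close>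

definition commutator_subgroup :: "('a, 'b) monoid_scheme \<Rightarrow> 'a set \<Rightarrow> 'a set \<Rightarrow> 'a set" where
  "commutator_subgroup G H K =
     generate G (\<Union>h\<in>H. \<Union>k\<in>K. {h \<otimes>\<^bsub>G\<^esub> k \<otimes>\<^bsub>G\<^esub> inv\<^bsub>G\<^esub> h \<otimes>\<^bsub>G\<^esub> inv\<^bsub>G\<^esub> k})"

text \<open>The index is shifted by one: \<open>lower_central_series G i\<close> is usually written
  \<open>\<gamma>\<close> with index \<open>i + 1\<close>.\<close>

primrec lower_central_series :: "('a, 'b) monoid_scheme \<Rightarrow> nat \<Rightarrow> 'a set" where
  "lower_central_series G 0 = carrier G"
| "lower_central_series G (Suc i) = commutator_subgroup G (lower_central_series G i) (carrier G)"

definition residually_nilpotent :: "('a, 'b) monoid_scheme \<Rightarrow> bool" where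
  "residually_nilpotent G \<longleftrightarrow> group G \<and> (\<Inter>i. lower_central_series G i) = {\<one>\<^bsub>G\<^esub>}"


section \<open>The space \<open>Q\<^sub>n\<close>\<close>

text \<open>
  The circle is the unit circle of \<open>\<complex>\<close>, and \<open>b\<close> is its distinguished point \<open>\<infinity>\<close>.
  A point of the torus of dimension \<open>n - 1\<close> is a function on \<open>nat\<close> with coordinates indexed by
  \<open>1, ..., n - 1\<close> and the fixed value \<open>undefined\<close> elsewhere. The type \<open>nat \<Rightarrow> complex\<close> carries the
  topology of pointwise convergence, which induces the product topology on this set.
  The convention \<open>x\<^sub>n = \<infinity>\<close> is the update \<open>x(n := b)\<close>.
\<close>

definition torus :: "nat \<Rightarrow> (nat \<Rightarrow> complex) set" where
  "torus n = (\<Pi>\<^sub>E i\<in>{1..<n}. sphere 0 1)"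

definition triple_diagonal :: "nat \<Rightarrow> complex \<Rightarrow> nat \<Rightarrow> nat \<Rightarrow> nat \<Rightarrow> (nat \<Rightarrow> complex) set" where
  "triple_diagonal n b i j k =
     {x \<in> torus n. (x(n := b)) i = (x(n := b)) j \<and> (x(n := b)) j = (x(n := b)) k}"

definition Q_space :: "nat \<Rightarrow> complex \<Rightarrow> (nat \<Rightarrow> complex) set" where
  "Q_space n b =
     torus n - (\<Union>(i, j, k) \<in> {(i, j, k). 1 \<le> i \<and> i < j \<and> j < k \<and> k \<le> n}. triple_diagonal n b i j k)"

definition round_twin_group ::
    "nat \<Rightarrow> complex \<Rightarrow> (nat \<Rightarrow> complex) \<Rightarrow> (real \<Rightarrow> nat \<Rightarrow> complex) set monoid" where
  "round_twin_group n b x = fundamental_group (Q_space n b) x"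

end

theory Submission
  imports Defs
begin

text \<open>
  For \<open>n \<le> 2\<close> the space is a torus and its fundamental group is abelian. For \<open>n \<ge> 3\<close>, record the
  pairs of indices whose points cross along a loop: this gives a homomorphism to the right-angled
  Coxeter group with one involution per pair in which disjoint pairs commute. It is injective,
  because a word that is trivial in the Coxeter group can be shortened by commutations and
  cancellations, and each of these moves is realized by a homotopy (after lifting to angles, every
  cell of the hyperplane arrangement obtained by crossing a matching of pairs is convex). The Coxeter
  group is residually nilpotent because sending each generator to \<open>1 + X\<close> with \<open>X\<^sup>2 = 0\<close> embeds
  it into the units of a graded algebra over the field with two elements.
\<close>


section \<open>Words acting on functions of traces\<close>

text \<open>For \<open>n\<close> = 2 the involution relation fails: a point that runs round the
  circle twice crosses the fixed one twice, yet the loop is not null-homotopic. For \<open>n\<close>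
  \<ge> 3 a third point stands in the way, so two successive crossings of one pair, with no other
  crossing in between, return to the same chamber. This is why small \<open>n\<close> is set apart.
  A path may cross walls infinitely often, and several walls at a time, so its word cannot simply be
  read off. Two devices replace general position. The homomorphism is the holonomy of transition
  maps that are defined pointwise and satisfy the cocycle identity only between nearby points;
  homotopy invariance holds for all such maps. Conversely, compactness of the interval gives some
  word whose chain of straight segments is homotopic to the path. The action is taken in its dual
  form because a function on traces supported in bounded length is lowered in length by every
  generator minus 1. Each commutator lowers it further, so an element of all terms of the lower
  central series fixes every such function.\<close>

locale commutation =
  fixes com :: "'a \<Rightarrow> 'a \<Rightarrow> bool"
  assumes com_irrefl [simp]: "\<not> com s s" and com_sym: "com s t \<Longrightarrow> com t s"
begin

text \<open>
  A word modulo commutations is determined by its length and its projections to all pairs of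
  noncommuting letters. Representing it by these data makes \<open>push\<close> respect commutations by
  construction, so that no normal forms are needed.
\<close>

type_synonym 'b trace = "nat \<times> ('b \<Rightarrow> 'b \<Rightarrow> 'b list)"

definition push :: "'a \<Rightarrow> 'a trace \<Rightarrow> 'a trace" where
  "push s \<tau> = (Suc (fst \<tau>),
     \<lambda>u v. if \<not> com u v \<and> (u = s \<or> v = s) then s # snd \<tau> u v else snd \<tau> u v)"

text \<open>The case \<open>v\<close> = \<open>s\<close> is included, as \<open>com\<close> is
  irreflexive; it forces \<open>s\<close> to occur at all. The other \<open>v\<close> say that no
  letter blocking \<open>s\<close> precedes its first occurrence.\<close>

definition headed :: "'a \<Rightarrow> 'a trace \<Rightarrow> bool" where
  "headed s \<tau> \<longleftrightarrow> (\<forall>v. \<not> com s v \<longrightarrow> (\<exists>r. snd \<tau> s v = s # r))"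

text \<open>
  The dual of left multiplication by \<open>1 + X\<close> on the space with basis the traces, over the field with
  two elements; \<open>X\<close> kills the traces from which \<open>s\<close> can be split off on the left.
\<close>

definition gen_act :: "'a \<Rightarrow> ('a trace \<Rightarrow> bool) \<Rightarrow> 'a trace \<Rightarrow> bool" where
  "gen_act s f = (\<lambda>\<tau>. f \<tau> \<noteq> (\<not> headed s \<tau> \<and> f (push s \<tau>)))"

definition act :: "'a list \<Rightarrow> ('a trace \<Rightarrow> bool) \<Rightarrow> 'a trace \<Rightarrow> bool" where
  "act w = fold gen_act w"

lemma act_simps [simp]:
  "act [] f = f" "act (s # w) f = act w (gen_act s f)" "act (u @ w) f = act w (act u f)"
  by (simp_all add: act_def)

lemma push_commute: "com s t \<Longrightarrow> push s (push t \<tau>) = push t (push s \<tau>)"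
  using com_sym by (auto simp: push_def fun_eq_iff)

lemma headed_push_self [simp]: "headed s (push s \<tau>)"
  by (auto simp: headed_def push_def)

lemma headed_push_commute: "com s t \<Longrightarrow> headed s (push t \<tau>) \<longleftrightarrow> headed s \<tau>"
  by (auto simp: headed_def push_def)

lemma gen_act_involution [simp]: "gen_act s (gen_act s f) = f"
  by (auto simp: gen_act_def fun_eq_iff)

lemma gen_act_commute: "com s t \<Longrightarrow> gen_act s (gen_act t f) = gen_act t (gen_act s f)"
  using com_sym[of s t]
  by (auto simp: gen_act_def fun_eq_iff push_commute[of s t] headed_push_commute)

lemma gen_act_act_commute:
  "(\<And>t. t \<in> set w \<Longrightarrow> com s t) \<Longrightarrow> gen_act s (act w f) = act w (gen_act s f)"
  by (induction w arbitrary: f) (auto simp: gen_act_commute)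

lemma act_rev [simp]: "act (rev w) (act w f) = f" "act w (act (rev w) f) = f"
proof -
  show *: "act (rev w) (act w f) = f" for w f
    by (induction w arbitrary: f) auto
  show "act w (act (rev w) f) = f"
    using *[of "rev w"] by simp
qed

text \<open>Commuting involutions multiply like their index sets under symmetric difference. This is
  the algebra behind the cocycle identity for crossings of a matching; \<open>L\<close> fixes an
  order of the factors.\<close>

lemma act_filter_filter:
  assumes "distinct L" "\<And>s t. s \<in> P \<Longrightarrow> t \<in> P \<Longrightarrow> s \<noteq> t \<Longrightarrow> com s t" "A \<subseteq> P" "B \<subseteq> P"
  shows "act (filter (\<lambda>s. s \<in> A) L) (act (filter (\<lambda>s. s \<in> B) L) f) =
         act (filter (\<lambda>s. (s \<in> A) \<noteq> (s \<in> B)) L) f"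
  using assms(1)
proof (induction L arbitrary: f)
  case (Cons s L)
  let ?F = "\<lambda>X. act (filter (\<lambda>s. s \<in> X) L)"
  have com: "gen_act s (?F B g) = ?F B (gen_act s g)" if "s \<in> P" for g
    using that Cons.prems assms(2,4) by (intro gen_act_act_commute) auto
  have IH: "?F A (?F B g) = act (filter (\<lambda>s. (s \<in> A) \<noteq> (s \<in> B)) L) g" for g
    using Cons by simp
  consider "s \<in> A" "s \<in> P" | "s \<notin> A"
    using assms(3) by blast
  then show ?case
  proof cases
    case 1
    then show ?thesis by (cases "s \<in> B") (simp_all add: com IH)
  next
    case 2
    then show ?thesis by (cases "s \<in> B") (simp_all add: IH)
  qed
qed simp

lemma act_filter_singleton:
  "distinct L \<Longrightarrow> s \<in> set L \<Longrightarrow> act (filter (\<lambda>t. t = s) L) f = gen_act s f"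
proof (induction L arbitrary: f)
  case (Cons t L)
  show ?case
  proof (cases "t = s")
    case True
    then have "filter (\<lambda>t. t = s) L = []" using Cons.prems by (auto simp: filter_empty_conv)
    then show ?thesis using True by simp
  qed (use Cons in auto)
qed simp

section \<open>The filtration by length and operators unipotent with respect to it\<close>

definition supp_below :: "nat \<Rightarrow> ('a trace \<Rightarrow> bool) set" where
  "supp_below k = {f. \<forall>\<tau>. f \<tau> \<longrightarrow> fst \<tau> < k}"

definition fxor :: "('a trace \<Rightarrow> bool) \<Rightarrow> ('a trace \<Rightarrow> bool) \<Rightarrow> 'a trace \<Rightarrow> bool" where
  "fxor f g = (\<lambda>\<tau>. f \<tau> \<noteq> g \<tau>)"

lemma fxor_self_right [simp]: "fxor f (fxor g f) = g"
  by (auto simp: fxor_def)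

lemma fxor_commute: "fxor f g = fxor g f"
  by (auto simp: fxor_def)

lemma fxor_trans: "fxor (fxor f g) (fxor g h) = fxor f h"
  by (auto simp: fxor_def)

lemma act_fxor: "act w (fxor f g) = fxor (act w f) (act w g)"
proof (induction w arbitrary: f g)
  case (Cons s w)
  have "gen_act s (fxor f g) = fxor (gen_act s f) (gen_act s g)"
    by (auto simp: gen_act_def fxor_def)
  then show ?case using Cons by simp
qed simp

lemma supp_below_fxor: "f \<in> supp_below k \<Longrightarrow> g \<in> supp_below k \<Longrightarrow> fxor f g \<in> supp_below k"
  by (auto simp: supp_below_def fxor_def)

lemma supp_below_mono: "f \<in> supp_below j \<Longrightarrow> j \<le> k \<Longrightarrow> f \<in> supp_below k"
  by (fastforce simp: supp_below_def)

text \<open>The operators that are the identity modulo a shift of the filtration by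
  \<open>j\<close>. Subtraction truncates, so for \<open>j\<close> \<ge> \<open>k\<close> the
  difference lies in \<open>supp_below 0\<close>, which contains only the zero function.\<close>

definition unipotent :: "nat \<Rightarrow> (('a trace \<Rightarrow> bool) \<Rightarrow> 'a trace \<Rightarrow> bool) set" where
  "unipotent j = {A. \<forall>k. \<forall>f\<in>supp_below k. fxor (A f) f \<in> supp_below (k - j)}"

lemma unipotentD: "A \<in> unipotent j \<Longrightarrow> f \<in> supp_below k \<Longrightarrow> fxor (A f) f \<in> supp_below (k - j)"
  by (auto simp: unipotent_def)

lemma unipotent_supp_below:
  assumes "A \<in> unipotent j" "f \<in> supp_below k"
  shows "A f \<in> supp_below k"
proof -
  have "fxor f (fxor (A f) f) \<in> supp_below k"
    by (rule supp_below_fxor[OF assms(2) supp_below_mono[OF unipotentD[OF assms]]]) simp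
  then show ?thesis unfolding fxor_self_right .
qed

lemma unipotent_comp:
  assumes "A \<in> unipotent j" "B \<in> unipotent j"
  shows "B \<circ> A \<in> unipotent j"
proof -
  have "fxor (B (A f)) f \<in> supp_below (k - j)" if "f \<in> supp_below k" for f k
    using supp_below_fxor[OF unipotentD[OF assms(2) unipotent_supp_below[OF assms(1) that]]
        unipotentD[OF assms(1) that]]
    by (simp add: fxor_trans)
  then show ?thesis by (auto simp: unipotent_def)
qed

text \<open>At a given trace, \<open>gen_act s f\<close> differs from \<open>f\<close> only through
  the value of \<open>f\<close> at a trace longer by one, so the bound on the support of the
  difference drops by one.\<close>

lemma act_unipotent: "act w \<in> unipotent 1"
proof (induction w)
  case Nil
  show ?case by (auto simp: unipotent_def supp_below_def fxor_def)
next
  case (Cons s w)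
  have "gen_act s \<in> unipotent 1"
    by (fastforce simp: unipotent_def supp_below_def fxor_def gen_act_def push_def)
  from unipotent_comp[OF this Cons.IH] show ?case
    by (simp add: comp_def)
qed

section \<open>Reduced words of the right-angled Coxeter group\<close>

primrec can_cancel :: "'a \<Rightarrow> 'a list \<Rightarrow> bool" where
  "can_cancel s [] \<longleftrightarrow> False"
| "can_cancel s (t # w) \<longleftrightarrow> t = s \<or> com s t \<and> can_cancel s w"

primrec reduced :: "'a list \<Rightarrow> bool" where
  "reduced [] \<longleftrightarrow> True"
| "reduced (s # w) \<longleftrightarrow> \<not> can_cancel s w \<and> reduced w"

definition trace_of :: "'a list \<Rightarrow> 'a trace" where
  "trace_of w = foldr push w (0, \<lambda>_ _. [])"

lemma headed_trace_of: "headed s (trace_of w) \<Longrightarrow> can_cancel s w"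
proof (induction w)
  case Nil
  then show ?case by (auto simp: headed_def trace_of_def dest: spec[of _ s])
next
  case (Cons t w)
  have e: "trace_of (t # w) = push t (trace_of w)" by (simp add: trace_of_def)
  show ?case
  proof (cases "t = s \<or> com s t")
    case True
    then show ?thesis using Cons by (auto simp: e headed_push_commute)
  next
    case False
    then show ?thesis using Cons.prems unfolding e headed_def push_def
      by (auto dest!: spec[of _ t])
  qed
qed

lemma fst_trace_of [simp]: "fst (trace_of w) = length w"
  by (induction w) (auto simp: trace_of_def push_def)

text \<open>Each letter lets an evaluation reach traces longer by at most one, so
  \<open>act w f\<close> at \<open>\<tau>\<close> sees \<open>f\<close> only up to length
  \<open>length w + fst \<tau>\<close>.\<close>

lemma act_short: "\<lbrakk>\<And>\<sigma>. f \<sigma> \<Longrightarrow> fst \<sigma> = N; length w + fst \<tau> < N\<rbrakk> \<Longrightarrow> \<not> act w f \<tau>"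
proof (induction w arbitrary: \<tau> rule: rev_induct)
  case (snoc s w)
  then show ?case by (auto simp: gen_act_def push_def)
qed auto

text \<open>When the product of the factors 1 + X is expanded, only the term with every X
  contributes in the top length, and reducedness says that X never kills the trace reached so far.
  The induction splits off the end of \<open>w\<close>, since the last letter acts last and is the
  first to be pushed onto \<open>u\<close>.\<close>

lemma act_reduced:
  "\<lbrakk>\<And>\<sigma>. f \<sigma> \<Longrightarrow> fst \<sigma> = length w + length u; reduced (w @ u)\<rbrakk>
    \<Longrightarrow> act w f (trace_of u) = f (trace_of (w @ u))"
proof (induction w arbitrary: u rule: rev_induct)
  case (snoc s w)
  have e: "trace_of (s # u) = push s (trace_of u)" by (simp add: trace_of_def)
  have "\<not> can_cancel s u"
    using snoc.prems(2) by (induction w) auto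
  then have "\<not> headed s (trace_of u)" using headed_trace_of by blast
  moreover have "\<not> act w f (trace_of u)"
    by (rule act_short[of _ "Suc (length w + length u)"]) (use snoc.prems(1) in \<open>auto\<close>)
  moreover have "act w f (trace_of (s # u)) = f (trace_of (w @ s # u))"
    by (rule snoc.IH) (use snoc.prems in auto)
  ultimately show ?case by (simp add: gen_act_def e)
qed simp

lemma reduced_act_trivial:
  assumes "reduced w" "\<And>f k. f \<in> supp_below k \<Longrightarrow> act w f = f"
  shows "w = []"
proof -
  let ?f = "\<lambda>\<sigma>. \<sigma> = trace_of w"
  have "act w ?f (trace_of []) = ?f (trace_of (w @ []))"
    using assms(1) by (intro act_reduced) auto
  moreover have "act w ?f = ?f"
    by (rule assms(2)[of _ "Suc (length w)"]) (unfold supp_below_def, auto simp del: split_paired_All)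
  ultimately have "trace_of [] = trace_of w" by simp
  then have "length w = length ([] :: 'a list)" by (metis fst_trace_of)
  then show ?thesis by simp
qed

end

section \<open>A criterion for residual nilpotence\<close>

context commutation begin

text \<open>With A = \<open>act w\<close> and signs irrelevant, the inverse of A minus 1 equals A -
  1 applied after the inverse of A, and the latter preserves the filtration.\<close>

lemma unipotent_act_rev:
  assumes "act w \<in> unipotent j"
  shows "act (rev w) \<in> unipotent j"
  using unipotentD[OF assms unipotent_supp_below[OF act_unipotent[of "rev w"]]]
  by (auto simp: unipotent_def fxor_commute)

text \<open>The operator of a commutator minus 1 is an invertible word operator times UV - VU, and
  UV - VU is the additive commutator of U - 1 and V - 1. Each of the two products in it lowers the
  filtration by \<open>j\<close> + 1.\<close>

lemma unipotent_commutator: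
  assumes "act u \<in> unipotent j"
  shows "act (u @ v @ rev u @ rev v) \<in> unipotent (Suc j)"
proof -
  have "fxor (act (u @ v @ rev u @ rev v) f) f \<in> supp_below (k - Suc j)"
    if f: "f \<in> supp_below k" for f k
  proof -
    define \<Delta> where "\<Delta> w f = fxor (act w f) f" for w f
    have "\<Delta> v (\<Delta> u f) \<in> supp_below (k - j - 1)" "\<Delta> u (\<Delta> v f) \<in> supp_below (k - 1 - j)"
      unfolding \<Delta>_def by (intro unipotentD[OF assms] unipotentD[OF act_unipotent] f)+
    then have "fxor (\<Delta> v (\<Delta> u f)) (\<Delta> u (\<Delta> v f)) \<in> supp_below (k - Suc j)"
      by (intro supp_below_fxor) (simp_all add: diff_commute)
    also have "fxor (\<Delta> v (\<Delta> u f)) (\<Delta> u (\<Delta> v f)) = fxor (act v (act u f)) (act u (act v f))"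
      unfolding \<Delta>_def act_fxor by (auto simp: fxor_def)
    finally have "act (rev u @ rev v) (fxor (act v (act u f)) (act u (act v f))) \<in> supp_below (k - Suc j)"
      by (rule unipotent_supp_below[OF act_unipotent])
    then show ?thesis
      unfolding act_fxor by simp
  qed
  then show ?thesis by (auto simp: unipotent_def)
qed

text \<open>The homomorphism reverses products, because words act from the right.\<close>

lemma residually_nilpotent_if_faithful_act:
  fixes G (structure) and hol :: "'g \<Rightarrow> ('a trace \<Rightarrow> bool) \<Rightarrow> 'a trace \<Rightarrow> bool"
  assumes "group G"
    and word: "\<And>x. x \<in> carrier G \<Longrightarrow> \<exists>w. hol x = act w"
    and mult: "\<And>x y. x \<in> carrier G \<Longrightarrow> y \<in> carrier G \<Longrightarrow> hol (x \<otimes> y) = hol y \<circ> hol x"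
    and faithful: "\<And>x. x \<in> carrier G \<Longrightarrow> (\<And>f k. f \<in> supp_below k \<Longrightarrow> hol x f = f) \<Longrightarrow> x = \<one>"
  shows "residually_nilpotent G"
proof -
  interpret group G by fact
  \<comment> \<open>A word operator that equals its own square is the identity, because words are
    invertible.\<close>
  have one: "hol \<one> = act []"
  proof -
    obtain w where w: "hol \<one> = act w" using word by blast
    have "act w (act w f) = act w f" for f
      using mult[of \<one> \<one>] w by (metis comp_apply one_closed r_one)
    then have "act w f = f" for f by (metis act_rev(1))
    then show ?thesis using w by (auto simp: fun_eq_iff)
  qed
  have hol_inv: "hol (inv x) = act (rev w)" if "x \<in> carrier G" "hol x = act w" for x w
  proof
    fix f
    have "hol (inv x) (act w f) = f" for f
      using mult[of x "inv x"] that one by (simp add: fun_eq_iff)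
    from this[of "act (rev w) f"] show "hol (inv x) f = act (rev w) f" by simp
  qed
  have lcs: "x \<in> carrier G \<and> hol x \<in> unipotent (Suc i)" if "x \<in> lower_central_series G i" for x i
    using that
  proof (induction i arbitrary: x)
    case 0
    then show ?case using word[of x] act_unipotent by auto
  next
    case (Suc i)
    let ?S = "\<Union>h\<in>lower_central_series G i. \<Union>k\<in>carrier G. {h \<otimes> k \<otimes> inv h \<otimes> inv k}"
    have S: "x \<in> carrier G \<and> hol x \<in> unipotent (Suc (Suc i))" if x_in: "x \<in> ?S" for x
    proof -
      obtain h k where hk: "h \<in> lower_central_series G i" "k \<in> carrier G"
        and x: "x = h \<otimes> k \<otimes> inv h \<otimes> inv k" using x_in by blast
      note h = Suc.IH[OF hk(1)]
      obtain u v where u: "hol h = act u" and v: "hol k = act v" using word h hk(2) by metis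
      have "hol x = act (u @ v @ rev u @ rev v)"
        using h hk(2) u v hol_inv[OF _ u] hol_inv[OF _ v] by (simp add: x mult comp_def act_def)
      then show ?thesis using unipotent_commutator[of u "Suc i" v] h hk(2) u by (auto simp: x)
    qed
    have "x \<in> generate G ?S" using Suc.prems by (simp add: commutator_subgroup_def)
    then show ?case
    proof induction
      case one
      then show ?case using \<open>hol \<one> = act []\<close> by (auto simp: unipotent_def supp_below_def fxor_def)
    next
      case (incl h)
      then show ?case by (rule S)
    next
      case (inv h)
      note h = S[OF inv]
      obtain w where w: "hol h = act w" using word h by blast
      then show ?case using h hol_inv[OF _ w] unipotent_act_rev by simp
    next
      case (eng h1 h2)
      have "hol (h1 \<otimes> h2) = hol h2 \<circ> hol h1" using mult eng.IH by blast
      then show ?case using eng.IH unipotent_comp by (metis m_closed)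
    qed
  qed
  have "x = \<one>" if x: "\<And>i. x \<in> lower_central_series G i" for x
  proof (rule faithful)
    show "x \<in> carrier G" using lcs[OF x] by simp
    fix f k assume "f \<in> supp_below k"
    \<comment> \<open>The term of index \<open>k\<close> shifts the filtration by
      \<open>Suc k\<close>, more than the bound \<open>k\<close> on \<open>f\<close>, so the
      difference vanishes.\<close>
    then have "fxor (hol x f) f \<in> supp_below (k - Suc k)"
      using lcs[OF x[of k]] unipotentD by blast
    then show "hol x f = f" by (simp add: supp_below_def fxor_def fun_eq_iff)
  qed
  moreover have "\<one> \<in> lower_central_series G i" for i
    by (cases i) (auto simp: commutator_subgroup_def intro: generate.one)
  ultimately have "(\<Inter>i. lower_central_series G i) = {\<one>}"
    by auto
  then show ?thesis
    using \<open>group G\<close> by (simp add: residually_nilpotent_def)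
qed

end

lemma residually_nilpotent_if_comm_group:
  assumes "comm_group G"
  shows "residually_nilpotent G"
proof -
  interpret comm_group G by fact
  let ?c = "\<lambda>h k. h \<otimes>\<^bsub>G\<^esub> k \<otimes>\<^bsub>G\<^esub> inv\<^bsub>G\<^esub> h \<otimes>\<^bsub>G\<^esub> inv\<^bsub>G\<^esub> k"
  have "?c h k = \<one>\<^bsub>G\<^esub>" if "h \<in> carrier G" "k \<in> carrier G" for h k
    using that by (simp add: m_assoc m_comm[of h k] flip: inv_mult_group)
  then have "(\<Union>h\<in>carrier G. \<Union>k\<in>carrier G. {?c h k}) \<subseteq> {\<one>\<^bsub>G\<^esub>}"
    by auto
  then have "lower_central_series G 1 \<subseteq> generate G {\<one>\<^bsub>G\<^esub>}"
    unfolding One_nat_def lower_central_series.simps commutator_subgroup_def by (rule mono_generate)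
  also have "generate G {\<one>\<^bsub>G\<^esub>} = {\<one>\<^bsub>G\<^esub>}"
    by (rule generate_one)
  finally have "(\<Inter>i. lower_central_series G i) \<subseteq> {\<one>\<^bsub>G\<^esub>}"
    by blast
  moreover have "\<one>\<^bsub>G\<^esub> \<in> lower_central_series G i" for i
    by (cases i) (auto simp: commutator_subgroup_def intro: generate.one)
  ultimately have "(\<Inter>i. lower_central_series G i) = {\<one>\<^bsub>G\<^esub>}"
    by auto
  then show ?thesis
    using is_group by (simp add: residually_nilpotent_def)
qed

section \<open>Abelian fundamental groups\<close>

lemma homotopic_paths_const_right:
  assumes "p \<in> loops_at S x"
  shows "homotopic_paths S (p +++ (\<lambda>_. x)) p"
proof (rule homotopic_paths_sym, rule homotopic_paths_reparametrize
    [where f = "\<lambda>t. if t \<le> 1/2 then 2 * t else 1"])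
  show "continuous_on {0..1} (\<lambda>t::real. if t \<le> 1/2 then 2 * t else 1)"
    unfolding split_01 by (rule continuous_on_cases continuous_intros | force)+
qed (use assms in \<open>auto simp: loops_at_def joinpaths_def pathfinish_def\<close>)

lemma homotopic_paths_pointwise:
  assumes "homotopic_paths S p p'" "homotopic_paths S q q'"
    and "continuous_on (S \<times> S) (\<lambda>z. m (fst z) (snd z))" "\<And>y z. y \<in> S \<Longrightarrow> z \<in> S \<Longrightarrow> m y z \<in> S"
  shows "homotopic_paths S (\<lambda>t. m (p t) (q t)) (\<lambda>t. m (p' t) (q' t))"
proof -
  obtain h :: "real \<times> real \<Rightarrow> 'a" where h: "continuous_on ({0..1} \<times> {0..1}) h" "h \<in> {0..1} \<times> {0..1} \<rightarrow> S"
    "\<forall>t\<in>{0..1}. h (0, t) = p t" "\<forall>t\<in>{0..1}. h (1, t) = p' t"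
    "\<forall>s\<in>{0..1}. h (s, 0) = p 0 \<and> h (s, 1) = p 1"
    using assms(1) unfolding homotopic_paths by (auto simp: pathstart_def pathfinish_def)
  obtain k :: "real \<times> real \<Rightarrow> 'a" where k: "continuous_on ({0..1} \<times> {0..1}) k" "k \<in> {0..1} \<times> {0..1} \<rightarrow> S"
    "\<forall>t\<in>{0..1}. k (0, t) = q t" "\<forall>t\<in>{0..1}. k (1, t) = q' t"
    "\<forall>s\<in>{0..1}. k (s, 0) = q 0 \<and> k (s, 1) = q 1"
    using assms(2) unfolding homotopic_paths by (auto simp: pathstart_def pathfinish_def)
  have "continuous_on ({0..1} \<times> {0..1}) (\<lambda>y. (h y, k y))"
    using h(1) k(1) by (rule continuous_on_Pair)
  then have "continuous_on ({0..1} \<times> {0..1}) (\<lambda>y. m (fst (h y, k y)) (snd (h y, k y)))"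
    by (rule continuous_on_compose2[OF assms(3)]) (use h(2) k(2) in auto)
  moreover have "(\<lambda>y. m (h y) (k y)) \<in> {0..1} \<times> {0..1} \<rightarrow> S"
    using h(2) k(2) assms(4) by blast
  ultimately show ?thesis
    unfolding homotopic_paths using h(3-5) k(3-5)
    by (intro exI[of _ "\<lambda>y. m (h y) (k y)"]) (auto simp: pathstart_def pathfinish_def)
qed

text \<open>Eckmann--Hilton: up to reparametrization, both orders of concatenation are the pointwise product.\<close>

lemma comm_group_fundamental_group:
  assumes "x \<in> S" "continuous_on (S \<times> S) (\<lambda>z. m (fst z) (snd z))" "\<And>y z. y \<in> S \<Longrightarrow> z \<in> S \<Longrightarrow> m y z \<in> S"
    and unit: "\<And>y. y \<in> S \<Longrightarrow> m x y = y" "\<And>y. y \<in> S \<Longrightarrow> m y x = y"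
  shows "comm_group (fundamental_group S x)"
proof -
  interpret group "fundamental_group S x" using assms(1) by (rule group_fundamental_group)
  have hom: "homotopic_paths S (p +++ q) (\<lambda>t. m (p t) (q t))" "homotopic_paths S (p +++ q) (\<lambda>t. m (q t) (p t))"
    if pq: "p \<in> loops_at S x" "q \<in> loops_at S x" for p q
  proof -
    \<comment> \<open>\<open>?p\<close> and \<open>?q\<close> move one at a time, while the other
      rests at the unit \<open>x\<close>. Their pointwise product is therefore equal to
      \<open>p +++ q\<close>, in either order of the factors.\<close>
    let ?p = "p +++ (\<lambda>_. x)" and ?q = "(\<lambda>_. x) +++ q"
    have h: "homotopic_paths S ?p p" "homotopic_paths S ?q q"
      using homotopic_paths_const_right[OF pq(1)] homotopic_paths_const_left[OF pq(2)] .
    have S: "p t \<in> S" "q t \<in> S" if "t \<in> {0..1}" for t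
      using pq that by (auto simp: loops_at_def path_image_def)
    have pj: "path (p +++ q)" "path_image (p +++ q) \<subseteq> S"
      using loops_at_join[OF pq] by (auto simp: loops_at_def)
    have "homotopic_paths S (p +++ q) (\<lambda>t. m (?p t) (?q t))" "homotopic_paths S (p +++ q) (\<lambda>t. m (?q t) (?p t))"
      using S by (intro homotopic_paths_eq[OF pj]; auto simp: joinpaths_def unit)+
    then show "homotopic_paths S (p +++ q) (\<lambda>t. m (p t) (q t))" "homotopic_paths S (p +++ q) (\<lambda>t. m (q t) (p t))"
      using homotopic_paths_pointwise[OF h assms(2,3)] homotopic_paths_pointwise[OF h(2,1) assms(2,3)]
        homotopic_paths_trans by blast+
  qed
  show ?thesis
  proof (rule group_comm_groupI)
    fix A B assume "A \<in> carrier (fundamental_group S x)" "B \<in> carrier (fundamental_group S x)"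
    then obtain p q where pq: "p \<in> loops_at S x" "q \<in> loops_at S x" and AB: "A = path_class S p" "B = path_class S q"
      by (auto simp: fundamental_group_def)
    have "homotopic_paths S (p +++ q) (q +++ p)"
      using hom(1)[OF pq] hom(2)[OF pq(2,1)] homotopic_paths_trans homotopic_paths_sym by blast
    then show "A \<otimes>\<^bsub>fundamental_group S x\<^esub> B = B \<otimes>\<^bsub>fundamental_group S x\<^esub> A"
      using pq by (simp add: AB fundamental_group_mult path_class_eqI)
  qed
qed

lemma comm_group_round_twin_group:
  assumes "n \<le> 2" "x \<in> Q_space n b"
  shows "comm_group (round_twin_group n b x)"
proof -
  have "\<not> (1 \<le> i \<and> i < j \<and> j < k \<and> k \<le> n)" for i j k
    using assms(1) by simp
  then have Q: "Q_space n b = torus n"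
    unfolding Q_space_def by blast
  have x: "x \<in> torus n" using assms(2) unfolding Q .
  \<comment> \<open>The multiplication of the torus, translated so that the base point
    \<open>x\<close> becomes the unit.\<close>
  define m where "m y z = (\<lambda>i\<in>{1..<n}. y i * z i * cnj (x i))" for y z :: "nat \<Rightarrow> complex"
  have norm: "norm (y i) = 1" if "y \<in> torus n" "i \<in> {1..<n}" for y i
    using that by (auto simp: torus_def PiE_iff)
  have ux: "x i * cnj (x i) = 1" if "i \<in> {1..<n}" for i
    using norm[OF x that] by (simp flip: complex_norm_square)
  have c: "continuous_on X (\<lambda>z. fst z i)" "continuous_on X (\<lambda>z. snd z i)"
    for i :: nat and X :: "((nat \<Rightarrow> complex) \<times> (nat \<Rightarrow> complex)) set"
    by (rule continuous_on_product_then_coordinatewise, intro continuous_intros)+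
  show ?thesis
    unfolding round_twin_group_def Q
  proof (rule comm_group_fundamental_group[OF x])
    show "continuous_on (torus n \<times> torus n) (\<lambda>z. m (fst z) (snd z))"
    proof (rule continuous_on_coordinatewise_then_product)
      fix i
      show "continuous_on (torus n \<times> torus n) (\<lambda>z. m (fst z) (snd z) i)"
        unfolding m_def by (cases "i \<in> {1..<n}") (auto intro!: continuous_intros c)
    qed
    show "m y z \<in> torus n" if "y \<in> torus n" "z \<in> torus n" for y z
      using norm that x by (auto simp: torus_def m_def norm_mult)
    show "m x y = y" "m y x = y" if "y \<in> torus n" for y
    proof -
      have ext: "y i = undefined" if "i \<notin> {1..<n}" for i
        using \<open>y \<in> torus n\<close> that by (auto simp: torus_def PiE_iff extensional_def)
      have "x i * y i * cnj (x i) = y i" "y i * x i * cnj (x i) = y i" if "i \<in> {1..<n}" for i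
        using ux[OF that] by (simp_all add: mult.assoc mult.left_commute[of "x i"])
      then show "m x y = y" "m y x = y"
        using ext by (auto simp: m_def fun_eq_iff)
    qed
  qed
qed

section \<open>Parallel transport along paths\<close>

text \<open>The transition maps of a flat connection on a trivial bundle with fibre
  \<open>'v\<close>. The identities are asked only between nearby points of \<open>S\<close>; a
  formula that miscounts crossings between distant points is admissible.\<close>

locale local_cocycle =
  fixes S :: "'a::topological_space set" and c :: "'a \<Rightarrow> 'a \<Rightarrow> 'v \<Rightarrow> 'v"
  assumes local_cocycle: "x \<in> S \<Longrightarrow> \<exists>U. open U \<and> x \<in> U \<and>
    (\<forall>y\<in>U \<inter> S. \<forall>f. c y y f = f) \<and>
    (\<forall>y\<in>U \<inter> S. \<forall>z\<in>U \<inter> S. \<forall>w\<in>U \<inter> S. \<forall>f. c z w (c y z f) = c y w f)"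
begin

definition cocycle_on :: "'a set \<Rightarrow> bool" where
  "cocycle_on U \<longleftrightarrow> open U \<and> (\<forall>y\<in>U \<inter> S. \<forall>f. c y y f = f) \<and>
    (\<forall>y\<in>U \<inter> S. \<forall>z\<in>U \<inter> S. \<forall>w\<in>U \<inter> S. \<forall>f. c z w (c y z f) = c y w f)"

lemma cocycle_onD:
  assumes "cocycle_on U" "y \<in> U" "y \<in> S"
  shows "c y y f = f"
    and "\<lbrakk>z \<in> U; z \<in> S; w \<in> U; w \<in> S\<rbrakk> \<Longrightarrow> c z w (c y z f) = c y w f"
  using assms by (auto simp: cocycle_on_def)

lemma cocycle_on_nhd: "x \<in> S \<Longrightarrow> \<exists>U. cocycle_on U \<and> x \<in> U"
  using local_cocycle[of x] unfolding cocycle_on_def by metis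

text \<open>\<open>v\<close> is a parallel section along \<open>p\<close>. Only times close to
  \<open>t\<close> are compared with \<open>t\<close>, so no subdivision of the interval is built
  in.\<close>

definition transport :: "(real \<Rightarrow> 'a) \<Rightarrow> real \<Rightarrow> real \<Rightarrow> (real \<Rightarrow> 'v) \<Rightarrow> bool" where
  "transport p a b v \<longleftrightarrow>
     (\<forall>t\<in>{a..b}. \<exists>d>0. \<forall>u\<in>{a..b}. \<bar>u - t\<bar> < d \<longrightarrow> v u = c (p t) (p u) (v t))"

lemma cocycle_on_along:
  fixes p :: "real \<Rightarrow> 'a"
  assumes "continuous_on {a..b} p" "p ` {a..b} \<subseteq> S" "t \<in> {a..b}"
  obtains d U where "d > 0" "cocycle_on U" "\<And>u. u \<in> {a..b} \<Longrightarrow> \<bar>u - t\<bar> < d \<Longrightarrow> p u \<in> U"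
proof -
  obtain U where U: "cocycle_on U" "p t \<in> U"
    using cocycle_on_nhd assms by blast
  have "open U" using U by (simp add: cocycle_on_def)
  have "(p \<longlongrightarrow> p t) (at t within {a..b})"
    using assms(1,3) unfolding continuous_on_def by blast
  then have "eventually (\<lambda>u. p u \<in> U) (at t within {a..b})"
    using \<open>open U\<close> U topological_tendstoD by blast
  then obtain d where d: "d > 0" "\<forall>u\<in>{a..b}. u \<noteq> t \<and> dist u t < d \<longrightarrow> p u \<in> U"
    unfolding eventually_at by blast
  then have "p u \<in> U" if "u \<in> {a..b}" "\<bar>u - t\<bar> < d" for u
    using that U(2) by (cases "u = t") (auto simp: dist_real_def)
  then show ?thesis using that[of d U] U d(1) by blast
qed

lemma transport_nhd:
  assumes "continuous_on {a..b} p" "p ` {a..b} \<subseteq> S" "transport p a b v" "t \<in> {a..b}"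
  obtains d where "d > 0" "\<And>u w. \<lbrakk>u \<in> {a..b}; w \<in> {a..b}; \<bar>u - t\<bar> < d; \<bar>w - t\<bar> < d\<rbrakk> \<Longrightarrow> v w = c (p u) (p w) (v u)"
proof -
  obtain d U where d: "d > 0" "cocycle_on U" "\<And>u. u \<in> {a..b} \<Longrightarrow> \<bar>u - t\<bar> < d \<Longrightarrow> p u \<in> U"
    using cocycle_on_along[OF assms(1,2,4)] by blast
  obtain e where e: "e > 0" "\<And>u. u \<in> {a..b} \<Longrightarrow> \<bar>u - t\<bar> < e \<Longrightarrow> v u = c (p t) (p u) (v t)"
    using assms(3,4) unfolding transport_def by blast
  show ?thesis
  proof (rule that[of "min d e"])
    fix u w assume uw: "u \<in> {a..b}" "w \<in> {a..b}" "\<bar>u - t\<bar> < min d e" "\<bar>w - t\<bar> < min d e"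
    have "p t \<in> U" "p u \<in> U" "p w \<in> U" "p t \<in> S" "p u \<in> S" "p w \<in> S"
      using d uw assms(2,4) by auto
    then show "v w = c (p u) (p w) (v u)"
      using e(2)[of u] e(2)[of w] uw cocycle_onD(2)[OF d(2)] by simp
  qed (use d e in auto)
qed

lemma transport_glue:
  assumes "transport p a b v" "transport p b e w" "v b = w b" "a \<le> b" "b \<le> e"
  shows "transport p a e (\<lambda>t. if t \<le> b then v t else w t)"
  unfolding transport_def
proof
  fix t assume t: "t \<in> {a..e}"
  consider "t < b" | "t = b" | "t > b" by linarith
  then show "\<exists>d>0. \<forall>u\<in>{a..e}. \<bar>u - t\<bar> < d \<longrightarrow>
    (if u \<le> b then v u else w u) = c (p t) (p u) (if t \<le> b then v t else w t)"
  proof cases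
    case 1
    then have "t \<in> {a..b}" using t by simp
    then obtain d where d: "d > 0" "\<forall>u\<in>{a..b}. \<bar>u - t\<bar> < d \<longrightarrow> v u = c (p t) (p u) (v t)"
      using assms(1) unfolding transport_def by blast
    show ?thesis
    proof (intro exI[of _ "min d (b - t)"] conjI ballI impI)
      fix u assume "u \<in> {a..e}" "\<bar>u - t\<bar> < min d (b - t)"
      then have "u \<in> {a..b}" "u \<le> b" "t \<le> b" "\<bar>u - t\<bar> < d" by auto
      then show "(if u \<le> b then v u else w u) = c (p t) (p u) (if t \<le> b then v t else w t)"
        using d(2) by presburger
    qed (use 1 d in auto)
  next
    case 2
    then have "t \<in> {a..b}" "t \<in> {b..e}" using t by auto
    then obtain d d' where d: "d > 0" "\<forall>u\<in>{a..b}. \<bar>u - t\<bar> < d \<longrightarrow> v u = c (p t) (p u) (v t)"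
      and d': "d' > 0" "\<forall>u\<in>{b..e}. \<bar>u - t\<bar> < d' \<longrightarrow> w u = c (p t) (p u) (w t)"
      using assms(1,2) unfolding transport_def by blast
    show ?thesis
    proof (intro exI[of _ "min d d'"] conjI ballI impI)
      fix u assume u: "u \<in> {a..e}" "\<bar>u - t\<bar> < min d d'"
      show "(if u \<le> b then v u else w u) = c (p t) (p u) (if t \<le> b then v t else w t)"
      proof (cases "u \<le> b")
        case True
        then have "v u = c (p t) (p u) (v t)" using d(2) u by simp
        then show ?thesis using True 2 by simp
      next
        case False
        then have "w u = c (p t) (p u) (w t)" using d'(2) u by simp
        moreover have "w t = v t" using 2 assms(3) by simp
        ultimately have "w u = c (p t) (p u) (v t)" by (simp only:)
        then show ?thesis using False 2 by simp
      qed
    qed (use d d' in auto)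
  next
    case 3
    then have "t \<in> {b..e}" using t by simp
    then obtain d where d: "d > 0" "\<forall>u\<in>{b..e}. \<bar>u - t\<bar> < d \<longrightarrow> w u = c (p t) (p u) (w t)"
      using assms(2) unfolding transport_def by blast
    show ?thesis
    proof (intro exI[of _ "min d (t - b)"] conjI ballI impI)
      fix u assume "u \<in> {a..e}" "\<bar>u - t\<bar> < min d (t - b)"
      then have "u \<in> {b..e}" "\<not> u \<le> b" "\<not> t \<le> b" "\<bar>u - t\<bar> < d" by auto
      then show "(if u \<le> b then v u else w u) = c (p t) (p u) (if t \<le> b then v t else w t)"
        using d(2) by presburger
    qed (use 3 d in auto)
  qed
qed

lemma transport_affine:
  assumes "transport p a b v" "m > 0" "\<And>t. t \<in> {a'..b'} \<Longrightarrow> m * t + k \<in> {a..b}"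
  shows "transport (\<lambda>t. p (m * t + k)) a' b' (\<lambda>t. v (m * t + k))"
  unfolding transport_def
proof
  fix t assume t: "t \<in> {a'..b'}"
  then obtain d where d: "d > 0" "\<forall>u\<in>{a..b}. \<bar>u - (m * t + k)\<bar> < d \<longrightarrow> v u = c (p (m * t + k)) (p u) (v (m * t + k))"
    using assms(1,3) unfolding transport_def by blast
  have "\<bar>m * u + k - (m * t + k)\<bar> < d" if "\<bar>u - t\<bar> < d / m" for u
  proof -
    have "\<bar>m * u + k - (m * t + k)\<bar> = m * \<bar>u - t\<bar>"
      using assms(2) abs_mult[of m "u - t"] by (simp add: right_diff_distrib)
    then show ?thesis using that assms(2) by (simp add: field_simps)
  qed
  then show "\<exists>d>0. \<forall>u\<in>{a'..b'}. \<bar>u - t\<bar> < d \<longrightarrow> v (m * u + k) = c (p (m * t + k)) (p (m * u + k)) (v (m * t + k))"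
    using d assms(2,3) by (intro exI[of _ "d / m"]) auto
qed

lemma transport_cong:
  assumes "transport p a b v" "\<And>t. t \<in> {a..b} \<Longrightarrow> p t = q t" "\<And>t. t \<in> {a..b} \<Longrightarrow> v t = w t"
  shows "transport q a b w"
  unfolding transport_def
proof
  fix t assume t: "t \<in> {a..b}"
  then obtain d where d: "d > 0" "\<And>u. u \<in> {a..b} \<Longrightarrow> \<bar>u - t\<bar> < d \<Longrightarrow> v u = c (p t) (p u) (v t)"
    using assms(1) unfolding transport_def by blast
  have "w u = c (q t) (q u) (w t)" if "u \<in> {a..b}" "\<bar>u - t\<bar> < d" for u
    using d(2)[OF that] assms(2,3)[OF t] assms(2,3)[OF that(1)] by argo
  then show "\<exists>d>0. \<forall>u\<in>{a..b}. \<bar>u - t\<bar> < d \<longrightarrow> w u = c (q t) (q u) (w t)"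
    using d(1) by blast
qed

lemma transport_subinterval:
  assumes "transport p a b v" "a \<le> a'" "b' \<le> b"
  shows "transport p a' b' v"
proof -
  have "{a'..b'} \<subseteq> {a..b}" using assms by auto
  then show ?thesis using assms(1) unfolding transport_def by blast
qed

lemma transport_exists:
  assumes "a \<le> b" "continuous_on {a..b} p" "p ` {a..b} \<subseteq> S"
  shows "\<exists>v. transport p a b v \<and> v a = f"
proof -
  define P where "P a' b' \<longleftrightarrow> (a \<le> a' \<longrightarrow> b' \<le> b \<longrightarrow> (\<forall>f. \<exists>v. transport p a' b' v \<and> v a' = f))" for a' b'
  have "P a b" using assms(1)
  proof (induction rule: Bolzano)
    case (trans a' b' c')
    have "\<exists>v. transport p a' c' v \<and> v a' = f" if ac: "a \<le> a'" "c' \<le> b" for f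
    proof -
      obtain v where v: "transport p a' b' v" "v a' = f"
        using trans ac unfolding P_def by (meson order_trans)
      obtain w where w: "transport p b' c' w" "w b' = v b'"
        using trans ac unfolding P_def by (meson order_trans)
      show ?thesis
        using transport_glue[OF v(1) w(1)] w(2) v(2) trans
        by (intro exI[of _ "\<lambda>t. if t \<le> b' then v t else w t"]) auto
    qed
    then show ?case by (auto simp: P_def)
  next
    case (local x)
    then obtain d U where d: "d > 0" "cocycle_on U" "\<And>u. u \<in> {a..b} \<Longrightarrow> \<bar>u - x\<bar> < d \<Longrightarrow> p u \<in> U"
      using cocycle_on_along[OF assms(2,3), of x] by auto
    have "\<exists>v. transport p a' b' v \<and> v a' = f"
      if ab: "a' \<le> x" "x \<le> b'" "b' - a' < d" "a \<le> a'" "b' \<le> b" for a' b' f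
    proof -
      have "p u \<in> U \<and> p u \<in> S" if "u \<in> {a'..b'}" for u
        using d(3)[of u] that ab assms(3) by auto
      then have "transport p a' b' (\<lambda>t. c (p a') (p t) f)"
        unfolding transport_def using ab cocycle_onD(2)[OF d(2)]
        by (intro ballI exI[of _ 1]) auto
      moreover have "c (p a') (p a') f = f"
        using ab \<open>\<And>u. u \<in> {a'..b'} \<Longrightarrow> _ u \<in> U \<and> _\<close>[of a'] by (intro cocycle_onD(1)[OF d(2)]) auto
      ultimately show ?thesis by blast
    qed
    then show ?case using d(1) unfolding P_def by blast
  qed
  then show ?thesis by (simp add: P_def)
qed

text \<open>Bolzano's principle, for relations that compose and hold on short intervals, multiplies
  finitely many transition maps. The set \<open>M\<close> serves two ends: \<open>UNIV\<close> gives
  uniqueness of the end value, and the set of all word operators shows that a holonomy is given by a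
  word.\<close>

lemma transport_composite:
  assumes "a \<le> b" "continuous_on {a..b} p" "p ` {a..b} \<subseteq> S"
    and c: "\<And>y z. c y z \<in> M" and comp: "\<And>A B. A \<in> M \<Longrightarrow> B \<in> M \<Longrightarrow> B \<circ> A \<in> M"
  shows "\<exists>A\<in>M. \<forall>v. transport p a b v \<longrightarrow> v b = A (v a)"
proof -
  define P where "P a' b' \<longleftrightarrow> (a \<le> a' \<longrightarrow> b' \<le> b \<longrightarrow> (\<exists>A\<in>M. \<forall>v. transport p a' b' v \<longrightarrow> v b' = A (v a')))" for a' b'
  have "P a b" using assms(1)
  proof (induction rule: Bolzano)
    case (trans a' b' c')
    have "\<exists>A\<in>M. \<forall>v. transport p a' c' v \<longrightarrow> v c' = A (v a')" if ac: "a \<le> a'" "c' \<le> b"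
    proof -
      obtain A where A: "A \<in> M" "\<And>v. transport p a' b' v \<Longrightarrow> v b' = A (v a')"
        using trans ac unfolding P_def by (meson order_trans)
      obtain B where B: "B \<in> M" "\<And>v. transport p b' c' v \<Longrightarrow> v c' = B (v b')"
        using trans ac unfolding P_def by (meson order_trans)
      show ?thesis
        using comp[OF A(1) B(1)] A(2) B(2) transport_subinterval trans(3,4)
        by (intro bexI[of _ "B \<circ> A"]) fastforce+
    qed
    then show ?case by (auto simp: P_def)
  next
    case (local x)
    then obtain d U where d: "d > 0" "cocycle_on U" "\<And>u. u \<in> {a..b} \<Longrightarrow> \<bar>u - x\<bar> < d \<Longrightarrow> p u \<in> U"
      using cocycle_on_along[OF assms(2,3), of x] by auto
    have "\<exists>A\<in>M. \<forall>v. transport p a' b' v \<longrightarrow> v b' = A (v a')"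
      if ab: "a' \<le> x" "x \<le> b'" "b' - a' < d" "a \<le> a'" "b' \<le> b" for a' b'
    proof (intro bexI[of _ "c (p a') (p b')"] allI impI c)
      fix v assume v: "transport p a' b' v"
      have US: "p u \<in> U \<and> p u \<in> S" if "u \<in> {a'..b'}" for u
        using d(3)[of u] that ab assms(3) by auto
      show "v b' = c (p a') (p b') (v a')"
      proof -
        \<comment> \<open>The section is controlled only between close times. A second use of
          Bolzano's principle, in which the cocycle identity on \<open>U\<close> gives transitivity,
          reaches from \<open>a'\<close> to \<open>b'\<close> with a single transition map.\<close>
        define Q where "Q s t \<longleftrightarrow> (a' \<le> s \<longrightarrow> t \<le> b' \<longrightarrow> v t = c (p s) (p t) (v s))" for s t
        have "a' \<le> b'" using ab by simp
        then have "Q a' b'"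
        proof (induction rule: Bolzano)
          case (trans r s t)
          then show ?case
            unfolding Q_def using US cocycle_onD(2)[OF d(2)] by auto
        next
          case (local y)
          have "continuous_on {a'..b'} p" "p ` {a'..b'} \<subseteq> S"
            using assms(2,3) ab by (auto intro: continuous_on_subset)
          from transport_nhd[OF this v, of y] local
          obtain e where "e > 0" "\<And>u w. \<lbrakk>u \<in> {a'..b'}; w \<in> {a'..b'}; \<bar>u - y\<bar> < e; \<bar>w - y\<bar> < e\<rbrakk> \<Longrightarrow> v w = c (p u) (p w) (v u)"
            by auto
          then show ?case unfolding Q_def by (intro exI[of _ e]) auto
        qed
        then show ?thesis by (simp add: Q_def)
      qed
    qed
    then show ?case using d(1) unfolding P_def by blast
  qed
  then show ?thesis by (simp add: P_def)
qed

text \<open>A relation rather than a function, since existence and uniqueness of the end value are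
  available only for paths inside \<open>S\<close>.\<close>

definition par :: "(real \<Rightarrow> 'a) \<Rightarrow> 'v \<Rightarrow> 'v \<Rightarrow> bool" where
  "par p f g \<longleftrightarrow> (\<exists>v. transport p 0 1 v \<and> v 0 = f \<and> v 1 = g)"

lemma par_exists: "path p \<Longrightarrow> path_image p \<subseteq> S \<Longrightarrow> \<exists>g. par p f g"
  using transport_exists[of 0 1 p f] by (auto simp: par_def path_def path_image_def)

lemma par_composite:
  assumes "path p" "path_image p \<subseteq> S" "\<And>y z. c y z \<in> M" "\<And>A B. A \<in> M \<Longrightarrow> B \<in> M \<Longrightarrow> B \<circ> A \<in> M"
  shows "\<exists>A\<in>M. \<forall>f g. par p f g \<longleftrightarrow> g = A f"
proof -
  obtain A where "A \<in> M" "\<And>v. transport p 0 1 v \<Longrightarrow> v 1 = A (v 0)"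
    using transport_composite[of 0 1 p M] assms by (auto simp: path_def path_image_def)
  then show ?thesis
    using par_exists[OF assms(1,2)] unfolding par_def by metis
qed

lemma par_unique: "path p \<Longrightarrow> path_image p \<subseteq> S \<Longrightarrow> par p f g \<Longrightarrow> par p f h \<Longrightarrow> g = h"
  using par_composite[of p UNIV] by auto

lemma par_join:
  assumes "par p f g" "par q g h" "pathfinish p = pathstart q"
  shows "par (p +++ q) f h"
proof -
  obtain v w where v: "transport p 0 1 v" "v 0 = f" "v 1 = g" and w: "transport q 0 1 w" "w 0 = g" "w 1 = h"
    using assms by (auto simp: par_def)
  have eq_half: "t * 2 = 1 \<Longrightarrow> t = 1/2" for t :: real
    by simp
  have "transport (p +++ q) 0 (1/2) (\<lambda>t. v (2 * t + 0))"
    by (rule transport_cong[OF transport_affine[OF v(1), of 2 0 "1/2" 0]]) (auto simp: joinpaths_def)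
  moreover have "transport (p +++ q) (1/2) 1 (\<lambda>t. w (2 * t + (-1)))"
    using assms(3)
    by (intro transport_cong[OF transport_affine[OF w(1), of 2 "1/2" 1 "-1"]])
       (auto simp: joinpaths_def pathfinish_def pathstart_def dest!: eq_half)
  ultimately show ?thesis
    unfolding par_def using v w
    by (intro exI[of _ "\<lambda>t. if t \<le> 1/2 then v (2 * t + 0) else w (2 * t + (-1))"] conjI transport_glue) auto
qed

lemma par_cong:
  assumes "\<And>t. t \<in> {0..1} \<Longrightarrow> p t = q t"
  shows "par p f g \<longleftrightarrow> par q f g"
  unfolding par_def
  using transport_cong[of p 0 1 _ q, OF _ assms refl] transport_cong[of q 0 1 _ p, OF _ assms[symmetric] refl]
  by blast

text \<open>The transition maps between corresponding points of two neighbouring paths of the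
  homotopy carry a parallel section along one to a parallel section along the other. The end points
  stay fixed, so both end values are unchanged.\<close>

lemma par_homotopic:
  assumes "homotopic_paths S p q" "par p f g"
  shows "par q f g"
proof -
  obtain h :: "real \<times> real \<Rightarrow> 'a" where cont: "continuous_on ({0..1} \<times> {0..1}) h" and hS: "h \<in> {0..1} \<times> {0..1} \<rightarrow> S"
    and left: "\<forall>t\<in>{0..1}. h (0, t) = p t" and right: "\<forall>t\<in>{0..1}. h (1, t) = q t"
    and ends: "\<forall>s\<in>{0..1}. h (s, 0) = p 0 \<and> h (s, 1) = p 1"
    using assms(1) unfolding homotopic_paths by (auto simp: pathstart_def pathfinish_def)
  define r where "r s t = h (s, t)" for s t :: real
  have r: "path (r s)" "path_image (r s) \<subseteq> S" if "s \<in> {0..1}" for s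
  proof -
    show "path (r s)"
      unfolding r_def path_def using that
      by (intro continuous_on_compose2[OF cont] continuous_intros) auto
    show "path_image (r s) \<subseteq> S"
      using hS that by (auto simp: path_image_def r_def)
  qed
  have rS: "r s t \<in> S" if "s \<in> {0..1}" "t \<in> {0..1}" for s t
    using hS that by (auto simp: r_def)
  have near: "\<exists>\<delta>>0. \<forall>s'\<in>{0..1}. \<bar>s' - s\<bar> < \<delta> \<longrightarrow> (\<forall>f g. par (r s) f g \<longrightarrow> par (r s') f g)"
    if s: "s \<in> {0..1}" for s
  proof -
    \<comment> \<open>A tube lemma: around \<open>t\<close> one set with the cocycle identity must
      contain all nearby points of the paths within \<open>\<delta>\<close> of \<open>s\<close>.
      Bolzano's principle then yields one \<open>\<delta>\<close> for all \<open>t\<close>.\<close>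
    define good where "good \<delta> t \<longleftrightarrow> (\<exists>\<epsilon>>0. \<exists>U. cocycle_on U \<and>
      (\<forall>s'\<in>{0..1}. \<forall>t'\<in>{0..1}. \<bar>s' - s\<bar> < \<delta> \<longrightarrow> \<bar>t' - t\<bar> < \<epsilon> \<longrightarrow> r s' t' \<in> U))" for \<delta> t
    have good_mono: "good \<delta> t" if "good \<delta>' t" "\<delta> \<le> \<delta>'" for \<delta> \<delta>' t
      using that unfolding good_def by (meson order.strict_trans2)
    define P where "P a b \<longleftrightarrow> (\<exists>\<delta>>0. \<forall>t\<in>{a..b} \<inter> {0..1}. good \<delta> t)" for a b
    have "P 0 1" using zero_le_one
    proof (induction rule: Bolzano)
      case (trans a b c)
      then obtain \<delta> \<delta>' where \<delta>: "\<delta> > 0" "\<And>t. t \<in> {a..b} \<inter> {0..1} \<Longrightarrow> good \<delta> t"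
        and \<delta>': "\<delta>' > 0" "\<And>t. t \<in> {b..c} \<inter> {0..1} \<Longrightarrow> good \<delta>' t"
        unfolding P_def by blast
      have "good (min \<delta> \<delta>') t" if "t \<in> {a..c} \<inter> {0..1}" for t
        using \<delta>(2)[of t] \<delta>'(2)[of t] good_mono that by (cases "t \<le> b") auto
      then show ?case unfolding P_def using \<delta>(1) \<delta>'(1) by (intro exI[of _ "min \<delta> \<delta>'"]) auto
    next
      case (local x)
      then obtain U where U: "cocycle_on U" "h (s, x) \<in> U"
        using cocycle_on_nhd[OF rS[OF s, of x]] by (auto simp: r_def)
      have "(h \<longlongrightarrow> h (s, x)) (at (s, x) within {0..1} \<times> {0..1})"
        using cont s local unfolding continuous_on_def by auto
      then have "eventually (\<lambda>y. h y \<in> U) (at (s, x) within {0..1} \<times> {0..1})"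
        using U by (auto intro: topological_tendstoD simp: cocycle_on_def)
      then obtain e where e: "e > 0" "\<And>y. y \<in> {0..1} \<times> {0..1} \<Longrightarrow> dist y (s, x) < e \<Longrightarrow> h y \<in> U"
        unfolding eventually_at using U(2) by metis
      have eU: "r s' t' \<in> U" if "s' \<in> {0..1}" "t' \<in> {0..1}" "\<bar>s' - s\<bar> < e/2" "\<bar>t' - x\<bar> < e/2" for s' t'
      proof -
        have "dist (s', t') (s, x) \<le> dist s' s + dist t' x"
          unfolding dist_Pair_Pair by (rule sqrt_sum_squares_le_sum) auto
        also have "\<dots> < e" using that by (auto simp: dist_real_def)
        finally show ?thesis unfolding r_def using that by (intro e) auto
      qed
      have "P a b" if "a \<le> x" "x \<le> b" "b - a < e/4" for a b
        unfolding P_def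
      proof (intro exI[of _ "e/2"] conjI ballI)
        fix t assume t: "t \<in> {a..b} \<inter> {0..1}"
        then have "\<bar>t - x\<bar> < e/4" using that(1,2) \<open>b - a < e/4\<close> by (simp add: abs_if)
        then show "good (e/2) t"
          unfolding good_def using e(1) U(1)
          by (intro exI[of _ "e/4"] conjI exI[of _ U] ballI impI eU) (auto simp: abs_if split: if_splits)
      qed (use e in auto)
      then show ?case using e(1) by (intro exI[of _ "e/4"]) auto
    qed
    then obtain \<delta> where \<delta>: "\<delta> > 0" "\<And>t. t \<in> {0..1} \<Longrightarrow> good \<delta> t"
      unfolding P_def by auto
    have "par (r s') f g" if s': "s' \<in> {0..1}" "\<bar>s' - s\<bar> < \<delta>" and fg: "par (r s) f g" for s' f g
    proof -
      obtain v where v: "transport (r s) 0 1 v" "v 0 = f" "v 1 = g"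
        using fg by (auto simp: par_def)
      define w where "w t = c (r s t) (r s' t) (v t)" for t
      have "transport (r s') 0 1 w"
        unfolding transport_def
      proof
        fix t :: real assume t: "t \<in> {0..1}"
        obtain \<epsilon> U where \<epsilon>: "\<epsilon> > 0" "cocycle_on U"
          "\<And>s' t'. \<lbrakk>s' \<in> {0..1}; t' \<in> {0..1}; \<bar>s' - s\<bar> < \<delta>; \<bar>t' - t\<bar> < \<epsilon>\<rbrakk> \<Longrightarrow> r s' t' \<in> U"
          using \<delta>(2)[OF t] unfolding good_def by blast
        obtain d where d: "d > 0" "\<And>u. u \<in> {0..1} \<Longrightarrow> \<bar>u - t\<bar> < d \<Longrightarrow> v u = c (r s t) (r s u) (v t)"
          using v(1) t unfolding transport_def by blast
        have "w u = c (r s' t) (r s' u) (w t)" if u: "u \<in> {0..1}" "\<bar>u - t\<bar> < min d \<epsilon>" for u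
        proof -
          have U: "r s t \<in> U" "r s u \<in> U" "r s' t \<in> U" "r s' u \<in> U"
            using u t s s' \<epsilon>(1) \<delta>(1) by (auto intro!: \<epsilon>(3))
          then show ?thesis
            using d(2)[of u] u t s s' rS by (simp add: w_def cocycle_onD(2)[OF \<epsilon>(2)])
        qed
        then show "\<exists>d>0. \<forall>u\<in>{0..1}. \<bar>u - t\<bar> < d \<longrightarrow> w u = c (r s' t) (r s' u) (w t)"
          using d(1) \<epsilon>(1) by (intro exI[of _ "min d \<epsilon>"]) auto
      qed
      moreover have id: "c y y f = f" if "y \<in> S" for y f
        using cocycle_on_nhd[OF that] cocycle_onD(1) that by blast
      have "w 0 = f" "w 1 = g"
        using ends s s' v id rS[OF s, of 0] rS[OF s, of 1] by (auto simp: w_def r_def)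
      ultimately show ?thesis by (auto simp: par_def)
    qed
    then show ?thesis using \<delta>(1) by blast
  qed
  define P where "P a b \<longleftrightarrow> (0 \<le> a \<longrightarrow> b \<le> 1 \<longrightarrow> (par (r a) f g \<longleftrightarrow> par (r b) f g))" for a b
  have "P 0 1" using zero_le_one
  proof (induction rule: Bolzano)
    case (trans a b c)
    then show ?case by (auto simp: P_def)
  next
    case (local x)
    then obtain \<delta> where \<delta>: "\<delta> > 0" "\<And>s' f g. s' \<in> {0..1} \<Longrightarrow> \<bar>s' - x\<bar> < \<delta> \<Longrightarrow> par (r x) f g \<Longrightarrow> par (r s') f g"
      using near[of x] by auto
    \<comment> \<open>The converse comes from existence and uniqueness: whatever \<open>f\<close> is
      transported to along \<open>r x\<close> is inherited by \<open>r s'\<close>, where it must be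
      \<open>g\<close>.\<close>
    have iff: "par (r x) f g \<longleftrightarrow> par (r s') f g" if s': "s' \<in> {0..1}" "\<bar>s' - x\<bar> < \<delta>" for s'
    proof -
      obtain g' where "par (r x) f g'"
        using par_exists[OF r, of x] local by auto
      with \<delta>(2)[OF s'] par_unique[OF r[OF s'(1)]] show ?thesis by metis
    qed
    have "P a b" if "a \<le> x" "x \<le> b" "b - a < \<delta>" for a b
      using that iff[of a] iff[of b] by (auto simp: P_def)
    then show ?case using \<delta>(1) by blast
  qed
  then have "par (r 0) f g \<longleftrightarrow> par (r 1) f g" by (simp add: P_def)
  moreover have "par (r 0) f g \<longleftrightarrow> par p f g" "par (r 1) f g \<longleftrightarrow> par q f g"
    using left right by (auto intro!: par_cong simp: r_def)
  ultimately show ?thesis using assms(2) by simp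
qed

end

section \<open>Configurations on the line\<close>

definition disjoint_pairs :: "nat \<times> nat \<Rightarrow> nat \<times> nat \<Rightarrow> bool" where
  "disjoint_pairs s t \<longleftrightarrow> {fst s, snd s} \<inter> {fst t, snd t} = {}"

locale configurations =
  fixes n :: nat and b :: complex
  assumes n3: "3 \<le> n" and norm_b: "norm b = 1"
begin

sublocale commutation disjoint_pairs
  by unfold_locales (auto simp: disjoint_pairs_def)

abbreviation "Q \<equiv> Q_space n b"

definition pairs :: "(nat \<times> nat) set" where
  "pairs = {(i, j). 1 \<le> i \<and> i < j \<and> j \<le> n}"

definition gap :: "nat \<times> nat \<Rightarrow> (nat \<Rightarrow> real) \<Rightarrow> real" where
  "gap s y = y (fst s) - y (snd s)"

text \<open>Coordinates are angles in full turns, lifted to the line, so two points of the circle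
  coincide exactly when their difference is an integer.\<close>

definition no_triple :: "(nat \<Rightarrow> real) \<Rightarrow> bool" where
  "no_triple y \<longleftrightarrow> (\<forall>i j k. 1 \<le> i \<longrightarrow> i < j \<longrightarrow> j < k \<longrightarrow> k \<le> n \<longrightarrow> \<not> (y i - y j \<in> \<int> \<and> y j - y k \<in> \<int>))"

text \<open>The floors name the chamber in the arrangement of walls where some gap is an integer. A
  configuration on a wall is counted to the side of larger gap, so each configuration has exactly
  one chamber.\<close>

definition crossed :: "(nat \<Rightarrow> real) \<Rightarrow> (nat \<Rightarrow> real) \<Rightarrow> (nat \<times> nat) set" where
  "crossed y z = {s \<in> pairs. \<lfloor>gap s y\<rfloor> \<noteq> \<lfloor>gap s z\<rfloor>}"

definition matching :: "(nat \<times> nat) set \<Rightarrow> bool" where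
  "matching P \<longleftrightarrow> (\<forall>s\<in>P. \<forall>t\<in>P. s \<noteq> t \<longrightarrow> disjoint_pairs s t)"

definition cell :: "(nat \<times> nat) set \<Rightarrow> (nat \<Rightarrow> real) \<Rightarrow> (nat \<Rightarrow> real) set" where
  "cell P a = {y. no_triple y \<and> crossed a y \<subseteq> P}"

lemma finite_pairs [simp]: "finite pairs"
  by (rule finite_subset[of _ "{..n} \<times> {..n}"]) (auto simp: pairs_def)

lemma finite_crossed [simp]: "finite (crossed y z)"
  by (rule finite_subset[OF _ finite_pairs]) (auto simp: crossed_def)

lemma matching_subset: "matching P \<Longrightarrow> R \<subseteq> P \<Longrightarrow> matching R"
  unfolding matching_def by blast

definition seg :: "(nat \<Rightarrow> real) \<Rightarrow> (nat \<Rightarrow> real) \<Rightarrow> real \<Rightarrow> nat \<Rightarrow> real" where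
  "seg y z u = (\<lambda>i. (1 - u) * y i + u * z i)"

lemma gap_seg: "gap s (seg y z u) = (1 - u) * gap s y + u * gap s z"
  by (simp add: gap_def seg_def algebra_simps)

lemma floor_convex:
  fixes p q u :: real
  assumes "\<lfloor>p\<rfloor> = m" "\<lfloor>q\<rfloor> = m" "0 \<le> u" "u \<le> 1"
  shows "\<lfloor>(1 - u) * p + u * q\<rfloor> = m"
proof -
  have pq: "of_int m \<le> p" "p < of_int m + 1" "of_int m \<le> q" "q < of_int m + 1"
    using assms by linarith+
  have "(1 - u) * p + u * q \<ge> of_int m"
    using convex_bound_le[of "-p" "- of_int m" "-q" "1 - u" u] pq assms by (simp add: algebra_simps)
  moreover have "(1 - u) * p + u * q < of_int m + 1"
    using convex_bound_lt[of p "of_int m + 1" q "1 - u" u] pq assms by simp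
  ultimately show ?thesis by linarith
qed

text \<open>The common floor is the only integer the combination can equal. It is the minimum of the
  half-open interval, so it is attained only if \<open>p\<close>, whose weight is positive, attains
  it.\<close>

lemma Ints_convex:
  fixes p q u :: real
  assumes "\<lfloor>p\<rfloor> = \<lfloor>q\<rfloor>" "0 \<le> u" "u < 1" "(1 - u) * p + u * q \<in> \<int>"
  shows "p \<in> \<int>"
proof -
  let ?m = "of_int \<lfloor>p\<rfloor> :: real"
  have pq: "?m \<le> p" "?m \<le> q"
    using assms(1) by linarith+
  have "\<lfloor>(1 - u) * p + u * q\<rfloor> = \<lfloor>p\<rfloor>"
    by (rule floor_convex) (use assms in auto)
  then have "(1 - u) * p + u * q = ?m"
    using assms(4) by (metis Ints_cases floor_of_int)
  then have "(1 - u) * (p - ?m) + u * (q - ?m) = 0"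
    by (simp add: algebra_simps)
  moreover have "(1 - u) * (p - ?m) \<ge> 0" "u * (q - ?m) \<ge> 0"
    using pq assms(2,3) by auto
  ultimately have "(1 - u) * (p - ?m) = 0" by linarith
  then have "p = ?m" using assms(3) by auto
  then show ?thesis by (metis Ints_of_int)
qed

text \<open>
  Among three pairs of indices from \<open>{i, j, k}\<close> at least two lie outside the matching, and a gap
  outside the matching can only become an integer inside a segment if it is one at the endpoints.
\<close>

lemma cell_convex:
  assumes "matching P" "y \<in> cell P a" "z \<in> cell P a" "0 \<le> u" "u \<le> 1"
  shows "seg y z u \<in> cell P a"
proof (cases "u = 1")
  case True
  then show ?thesis using assms by (simp add: seg_def)
next
  case False
  then have u: "0 \<le> u" "u < 1" using assms by auto
  have fl: "\<lfloor>gap s y\<rfloor> = \<lfloor>gap s a\<rfloor> \<and> \<lfloor>gap s z\<rfloor> = \<lfloor>gap s a\<rfloor>" if "s \<in> pairs - P" for s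
    using assms(2,3) that by (auto simp: cell_def crossed_def)
  have int: "gap s y \<in> \<int>" if "s \<in> pairs - P" "gap s (seg y z u) \<in> \<int>" for s
    using fl[OF that(1)] that(2) u by (intro Ints_convex[of "gap s y" "gap s z" u]) (auto simp: gap_seg)
  have "no_triple (seg y z u)"
    unfolding no_triple_def
  proof (intro allI impI notI)
    fix i j k assume ijk: "1 \<le> i" "i < j" "j < k" "k \<le> n"
      and "seg y z u i - seg y z u j \<in> \<int> \<and> seg y z u j - seg y z u k \<in> \<int>"
    then have I: "gap (i, j) (seg y z u) \<in> \<int>" "gap (j, k) (seg y z u) \<in> \<int>"
      by (auto simp: gap_def)
    then have I': "gap (i, k) (seg y z u) \<in> \<int>"
      using Ints_add[OF I] by (simp add: gap_def)
    have p: "(i, j) \<in> pairs" "(j, k) \<in> pairs" "(i, k) \<in> pairs"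
      using ijk by (auto simp: pairs_def)
    have "\<not> disjoint_pairs (i, j) (j, k)" "\<not> disjoint_pairs (i, j) (i, k)" "\<not> disjoint_pairs (j, k) (i, k)"
      by (auto simp: disjoint_pairs_def)
    then consider "(i, j) \<notin> P" "(j, k) \<notin> P" | "(i, j) \<notin> P" "(i, k) \<notin> P" | "(j, k) \<notin> P" "(i, k) \<notin> P"
      using assms(1) ijk unfolding matching_def by (metis Pair_inject nat_neq_iff)
    then have "gap (i, j) y \<in> \<int> \<and> gap (j, k) y \<in> \<int>"
    proof cases
      case 1
      then show ?thesis using int p I by auto
    next
      case 2
      then have "gap (i, j) y \<in> \<int>" "gap (i, k) y \<in> \<int>" using int p I I' by auto
      then show ?thesis using Ints_diff[of "gap (i, k) y" "gap (i, j) y"] by (simp add: gap_def)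
    next
      case 3
      then have "gap (j, k) y \<in> \<int>" "gap (i, k) y \<in> \<int>" using int p I I' by auto
      then show ?thesis using Ints_diff[of "gap (i, k) y" "gap (j, k) y"] by (simp add: gap_def)
    qed
    then show False
      using assms(2) ijk unfolding cell_def no_triple_def gap_def by auto
  qed
  moreover have "\<lfloor>gap s (seg y z u)\<rfloor> = \<lfloor>gap s a\<rfloor>" if "s \<in> pairs - P" for s
    unfolding gap_seg using fl[OF that] u by (intro floor_convex) auto
  then have "crossed a (seg y z u) \<subseteq> P"
    unfolding crossed_def by fastforce
  ultimately show ?thesis
    by (simp add: cell_def)
qed

text \<open>Angles are taken relative to the \<open>n\<close>-th point, which thereby sits at
  \<open>b\<close>; a simultaneous translation of all coordinates is invisible.\<close>

definition emb :: "(nat \<Rightarrow> real) \<Rightarrow> nat \<Rightarrow> complex" where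
  "emb y = (\<lambda>i\<in>{1..<n}. b * cis (2 * pi * (y i - y n)))"

lemma emb_upd: "i \<in> {1..n} \<Longrightarrow> ((emb y)(n := b)) i = b * cis (2 * pi * (y i - y n))"
  by (auto simp: emb_def)

lemma cis_eq_iff: "cis (2 * pi * p) = cis (2 * pi * q) \<longleftrightarrow> p - q \<in> \<int>"
proof -
  have "cis (2 * pi * p) = cis (2 * pi * q) \<longleftrightarrow> (\<exists>m::int. 2 * pi * p = 2 * pi * q + 2 * pi * m)"
    using sin_cos_eq_iff[of "2 * pi * p" "2 * pi * q"] by (auto simp: complex_eq_iff)
  also have "\<dots> \<longleftrightarrow> (\<exists>m::int. p - q = m)"
  proof -
    have "2 * pi * p = 2 * pi * q + 2 * pi * m \<longleftrightarrow> p - q = m" for m :: int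
    proof -
      have "2 * pi * p = 2 * pi * q + 2 * pi * m \<longleftrightarrow> 2 * pi * p = 2 * pi * (q + m)"
        by (simp add: algebra_simps)
      then show ?thesis by auto
    qed
    then show ?thesis by simp
  qed
  finally show ?thesis by (auto simp: Ints_def)
qed

lemma emb_coord_eq_iff:
  assumes "i \<in> {1..n}" "j \<in> {1..n}"
  shows "((emb y)(n := b)) i = ((emb y)(n := b)) j \<longleftrightarrow> y i - y j \<in> \<int>"
  using norm_b assms by (simp only: emb_upd) (auto simp: cis_eq_iff)

lemma emb_in_Q_iff: "emb y \<in> Q \<longleftrightarrow> no_triple y"
proof -
  have "emb y \<in> torus n"
    using norm_b by (auto simp: torus_def emb_def norm_mult)
  then have "emb y \<in> Q \<longleftrightarrow> (\<forall>i j k. 1 \<le> i \<and> i < j \<and> j < k \<and> k \<le> n \<longrightarrow>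
      \<not> (((emb y)(n := b)) i = ((emb y)(n := b)) j \<and> ((emb y)(n := b)) j = ((emb y)(n := b)) k))"
    unfolding Q_space_def triple_diagonal_def by blast
  also have "\<dots> \<longleftrightarrow> no_triple y"
    unfolding no_triple_def by (intro all_cong1) (auto simp: emb_coord_eq_iff simp del: fun_upd_apply)
  finally show ?thesis .
qed

lemma continuous_emb: "continuous_on X emb"
proof (rule continuous_on_coordinatewise_then_product)
  fix i
  have c: "continuous_on X (\<lambda>y. y j)" for j :: nat and X :: "(nat \<Rightarrow> real) set"
    by (rule continuous_on_subset[OF continuous_on_product_coordinates]) simp
  show "continuous_on X (\<lambda>y. emb y i)"
    unfolding emb_def by (cases "i \<in> {1..<n}") (auto intro!: continuous_intros c)
qed

lemma path_emb: "path f \<Longrightarrow> path (emb \<circ> f)"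
  by (rule path_continuous_image[OF _ continuous_emb])

lemma path_image_emb: "(\<And>t. t \<in> {0..1} \<Longrightarrow> no_triple (f t)) \<Longrightarrow> path_image (emb \<circ> f) \<subseteq> Q"
  by (auto simp: path_image_def emb_in_Q_iff)

text \<open>The straight-line homotopy of the lifts stays in the convex cell. Apart from
  reparametrization and the formal rules for concatenation, all homotopies in \<open>Q\<close> come
  from here.\<close>

lemma homotopic_emb:
  assumes "path f" "path g" "f 0 = g 0" "f 1 = g 1" "matching P"
    and "\<And>t. t \<in> {0..1} \<Longrightarrow> f t \<in> cell P a" "\<And>t. t \<in> {0..1} \<Longrightarrow> g t \<in> cell P a"
  shows "homotopic_paths Q (emb \<circ> f) (emb \<circ> g)"
proof -
  define h where "h y = emb (seg (f (snd y)) (g (snd y)) (fst y))" for y :: "real \<times> real"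
  have c: "continuous_on {0..1} (\<lambda>t. f t i)" "continuous_on {0..1} (\<lambda>t. g t i)" for i
    using assms(1,2) unfolding path_def by (auto intro: continuous_on_product_then_coordinatewise)
  have "continuous_on ({0..1} \<times> {0..1}) (\<lambda>y. seg (f (snd y)) (g (snd y)) (fst y))"
    unfolding seg_def
    by (intro continuous_on_coordinatewise_then_product continuous_intros continuous_on_compose2[OF c(1)] continuous_on_compose2[OF c(2)]) auto
  then have "continuous_on ({0..1} \<times> {0..1}) h"
    unfolding h_def by (rule continuous_on_compose2[OF continuous_emb]) auto
  moreover have "h y \<in> Q" if "y \<in> {0..1} \<times> {0..1}" for y
    using cell_convex[OF assms(5) assms(6)[of "snd y"] assms(7)[of "snd y"], of "fst y"] that
    by (auto simp: h_def emb_in_Q_iff cell_def)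
  moreover have "seg y y u = y" for y u
    by (simp add: seg_def algebra_simps)
  ultimately show ?thesis
    unfolding homotopic_paths using assms(3,4)
    by (intro exI[of _ h]) (auto simp: h_def pathstart_def pathfinish_def, auto simp: seg_def)
qed

lemma path_seg [simp]: "path (seg y z)"
  unfolding path_def seg_def by (intro continuous_on_coordinatewise_then_product continuous_intros)

lemma seg_ends [simp]: "seg y z 0 = y" "seg y z 1 = z"
  by (auto simp: seg_def)

lemma pathstart_emb_seg [simp]: "pathstart (emb \<circ> seg y z) = emb y" "pathfinish (emb \<circ> seg y z) = emb z"
  by (auto simp: pathstart_def pathfinish_def)

lemma self_in_cell: "no_triple y \<Longrightarrow> y \<in> cell P y"
  by (simp add: cell_def crossed_def)

lemma seg_in_cell:
  assumes "matching P" "y \<in> cell P a" "z \<in> cell P a" "t \<in> {0..1}"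
  shows "seg y z t \<in> cell P a"
  using cell_convex assms by auto

lemma seg_join_homotopic:
  assumes "matching P" "x \<in> cell P a" "y \<in> cell P a" "z \<in> cell P a"
  shows "homotopic_paths Q ((emb \<circ> seg x y) +++ (emb \<circ> seg y z)) (emb \<circ> seg x z)"
proof -
  have "homotopic_paths Q (emb \<circ> (seg x y +++ seg y z)) (emb \<circ> seg x z)"
  proof (rule homotopic_emb)
    show "path (seg x y +++ seg y z)"
      by (simp add: pathfinish_def pathstart_def)
    show "(seg x y +++ seg y z) t \<in> cell P a" if "t \<in> {0..1}" for t
      using that seg_in_cell[OF assms(1-3), of "2 * t"] seg_in_cell[OF assms(1,3,4), of "2 * t - 1"]
      by (auto simp: joinpaths_def)
  qed (use assms seg_in_cell in \<open>auto simp: joinpaths_def\<close>)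
  then show ?thesis by (simp add: path_compose_join)
qed

section \<open>Generic configurations, and how a third point restricts the crossings of a
  pair\<close>

definition generic :: "(nat \<Rightarrow> real) \<Rightarrow> bool" where
  "generic y \<longleftrightarrow> (\<forall>s\<in>pairs. gap s y \<notin> \<int>)"

lemma generic_no_triple: "generic y \<Longrightarrow> no_triple y"
  unfolding generic_def no_triple_def gap_def pairs_def by fastforce

lemma generic_exists: "\<exists>g. generic g \<and> (\<forall>s\<in>pairs. \<lfloor>gap s g\<rfloor> = \<lfloor>gap s y\<rfloor>)"
proof -
  \<comment> \<open>The perturbation raises the gap of every pair, the first index being the smaller
    one. Floors are continuous in that direction, so a small \<open>\<epsilon>\<close> keeps all of
    them and moves integral gaps off their walls.\<close>
  define g where "g \<epsilon> i = y i - \<epsilon> * real i" for \<epsilon> :: real and i :: nat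
  have gap: "gap s (g \<epsilon>) = gap s y + \<epsilon> * (real (snd s) - real (fst s))" for s \<epsilon>
    by (simp add: gap_def g_def algebra_simps)
  have "eventually (\<lambda>\<epsilon>. \<forall>s\<in>pairs. gap s (g \<epsilon>) < of_int \<lfloor>gap s y\<rfloor> + 1) (at_right 0)"
  proof (rule eventually_ball_finite[OF finite_pairs], rule ballI)
    fix s
    have "((\<lambda>\<epsilon>. gap s (g \<epsilon>)) \<longlongrightarrow> gap s y + 0 * (real (snd s) - real (fst s))) (at_right 0)"
      unfolding gap by (intro tendsto_intros)
    then show "eventually (\<lambda>\<epsilon>. gap s (g \<epsilon>) < of_int \<lfloor>gap s y\<rfloor> + 1) (at_right 0)"
      by (intro order_tendstoD(2)) auto
  qed
  moreover have "eventually (\<lambda>\<epsilon>::real. \<epsilon> > 0) (at_right 0)"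
    by (rule eventually_at_right_less)
  ultimately have "eventually (\<lambda>\<epsilon>. (\<forall>s\<in>pairs. gap s (g \<epsilon>) < of_int \<lfloor>gap s y\<rfloor> + 1) \<and> \<epsilon> > 0) (at_right 0)"
    by (rule eventually_conj)
  then obtain \<epsilon> where \<epsilon>: "\<epsilon> > 0" and lt: "\<And>s. s \<in> pairs \<Longrightarrow> gap s (g \<epsilon>) < of_int \<lfloor>gap s y\<rfloor> + 1"
    using eventually_happens'[OF trivial_limit_at_right_real] by blast
  have gt: "gap s (g \<epsilon>) > of_int \<lfloor>gap s y\<rfloor>" if "s \<in> pairs" for s
  proof -
    have "\<epsilon> * (real (snd s) - real (fst s)) > 0"
      using that \<epsilon> by (auto simp: pairs_def)
    then show ?thesis unfolding gap by linarith
  qed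
  have "\<lfloor>gap s (g \<epsilon>)\<rfloor> = \<lfloor>gap s y\<rfloor> \<and> gap s (g \<epsilon>) \<notin> \<int>" if s: "s \<in> pairs" for s
  proof
    show fl: "\<lfloor>gap s (g \<epsilon>)\<rfloor> = \<lfloor>gap s y\<rfloor>" using lt[OF s] gt[OF s] by linarith
    show "gap s (g \<epsilon>) \<notin> \<int>"
      using fl gt[OF s] by (metis floor_of_int Ints_cases less_irrefl)
  qed
  then show ?thesis unfolding generic_def by blast
qed

lemma floor_diff_sym:
  fixes p q :: real
  assumes "p - q \<notin> \<int>"
  shows "\<lfloor>q - p\<rfloor> = - 1 - \<lfloor>p - q\<rfloor>"
proof -
  have "p - q \<noteq> of_int \<lfloor>p - q\<rfloor>" using assms by (metis Ints_of_int)
  then show ?thesis by linarith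
qed

text \<open>Given the floors of two points relative to a third, only two values remain for the floor
  of their own difference.\<close>

lemma floor_diff_cases:
  fixes p q r :: real
  shows "\<lfloor>p - q\<rfloor> = \<lfloor>p - r\<rfloor> - \<lfloor>q - r\<rfloor> - 1 \<or> \<lfloor>p - q\<rfloor> = \<lfloor>p - r\<rfloor> - \<lfloor>q - r\<rfloor>"
  by linarith

definition ord_pair :: "nat \<Rightarrow> nat \<Rightarrow> nat \<times> nat" where
  "ord_pair i j = (min i j, max i j)"

text \<open>\<open>pairs\<close> lists each pair in one order only; for generic configurations the
  floor of the opposite difference is determined too.\<close>

lemma generic_floor_eq:
  assumes "generic y" "generic z" "i \<in> {1..n}" "j \<in> {1..n}" "i \<noteq> j"
    and "\<lfloor>gap (ord_pair i j) y\<rfloor> = \<lfloor>gap (ord_pair i j) z\<rfloor>"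
  shows "\<lfloor>y i - y j\<rfloor> = \<lfloor>z i - z j\<rfloor>"
proof (cases "i < j")
  case True
  then show ?thesis using assms by (simp add: ord_pair_def gap_def)
next
  case False
  then have ji: "(j, i) \<in> pairs" "ord_pair i j = (j, i)" using assms by (auto simp: pairs_def ord_pair_def)
  then have "y j - y i \<notin> \<int>" "z j - z i \<notin> \<int>"
    using assms(1,2) unfolding generic_def gap_def by fastforce+
  from this[THEN floor_diff_sym] show ?thesis
    using assms(6) ji(2) by (simp add: gap_def)
qed

lemma third_index: obtains x where "x \<in> {1..n}" "x \<noteq> k" "x \<noteq> (l::nat)"
proof -
  have "card {k, l} < card {1..n}" using n3 by (simp add: card_insert_if)
  then have "\<not> {1..n} \<subseteq> {k, l}" by (meson card_mono finite.emptyI finite.insertI leD)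
  then show ?thesis using that by blast
qed

lemma crossed_sym: "crossed y z = crossed z y"
  by (auto simp: crossed_def)

lemma ord_pair_in_pairs: "i \<in> {1..n} \<Longrightarrow> j \<in> {1..n} \<Longrightarrow> i \<noteq> j \<Longrightarrow> ord_pair i j \<in> pairs"
  by (auto simp: ord_pair_def pairs_def)

text \<open>The floors of the two points of \<open>s\<close> relative to a third one stay the same
  throughout, which leaves two possible floors for \<open>s\<close> itself. A quantity with two
  values that changes twice returns.\<close>

lemma crossed_twice:
  assumes "crossed x y = {s}" "crossed y z = {s}"
  shows "crossed x z = {}"
proof -
  have s: "s \<in> pairs" and ne: "\<lfloor>gap s x\<rfloor> \<noteq> \<lfloor>gap s y\<rfloor>" "\<lfloor>gap s y\<rfloor> \<noteq> \<lfloor>gap s z\<rfloor>"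
    using assms by (auto simp: crossed_def)
  obtain k l where kl: "s = (k, l)" by fastforce
  have kl': "k \<in> {1..n}" "l \<in> {1..n}" "k < l" using s kl by (auto simp: pairs_def)
  obtain r where r: "r \<in> {1..n}" "r \<noteq> k" "r \<noteq> l" using third_index .
  obtain x' where x': "generic x'" "\<And>t. t \<in> pairs \<Longrightarrow> \<lfloor>gap t x'\<rfloor> = \<lfloor>gap t x\<rfloor>"
    using generic_exists by blast
  obtain y' where y': "generic y'" "\<And>t. t \<in> pairs \<Longrightarrow> \<lfloor>gap t y'\<rfloor> = \<lfloor>gap t y\<rfloor>"
    using generic_exists by blast
  obtain z' where z': "generic z'" "\<And>t. t \<in> pairs \<Longrightarrow> \<lfloor>gap t z'\<rfloor> = \<lfloor>gap t z\<rfloor>"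
    using generic_exists by blast
  have eq: "\<lfloor>gap t x\<rfloor> = \<lfloor>gap t y\<rfloor> \<and> \<lfloor>gap t y\<rfloor> = \<lfloor>gap t z\<rfloor>" if "t \<in> pairs" "t \<noteq> s" for t
    using assms that unfolding crossed_def by blast
  have neq: "ord_pair k r \<noteq> s" "ord_pair l r \<noteq> s"
    using r kl kl' by (auto simp: ord_pair_def)
  have xy: "\<lfloor>x' i - x' r\<rfloor> = \<lfloor>y' i - y' r\<rfloor>" "\<lfloor>y' i - y' r\<rfloor> = \<lfloor>z' i - z' r\<rfloor>" if "i = k \<or> i = l" for i
  proof -
    have i: "i \<in> {1..n}" "i \<noteq> r" "ord_pair i r \<noteq> s"
      using that r kl' neq by auto
    have p: "ord_pair i r \<in> pairs" using ord_pair_in_pairs i r by blast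
    show "\<lfloor>x' i - x' r\<rfloor> = \<lfloor>y' i - y' r\<rfloor>" "\<lfloor>y' i - y' r\<rfloor> = \<lfloor>z' i - z' r\<rfloor>"
      using x'(2)[OF p] y'(2)[OF p] z'(2)[OF p] eq[OF p i(3)]
      by (intro generic_floor_eq x'(1) y'(1) z'(1) i r; simp)+
  qed
  have g: "\<lfloor>gap s x\<rfloor> = \<lfloor>x' k - x' l\<rfloor>" "\<lfloor>gap s y\<rfloor> = \<lfloor>y' k - y' l\<rfloor>" "\<lfloor>gap s z\<rfloor> = \<lfloor>z' k - z' l\<rfloor>"
    using x' y' z' s by (auto simp: kl gap_def)
  have "\<lfloor>gap s x\<rfloor> = \<lfloor>gap s z\<rfloor>"
    using ne xy[of k] xy[of l] floor_diff_cases[of "x' k" "x' l" "x' r"]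
      floor_diff_cases[of "y' k" "y' l" "y' r"] floor_diff_cases[of "z' k" "z' l" "z' r"]
    unfolding g by auto
  then have "\<lfloor>gap t x\<rfloor> = \<lfloor>gap t z\<rfloor>" if "t \<in> pairs" for t
    using eq[OF that] by (cases "t = s") auto
  then show ?thesis by (simp add: crossed_def)
qed

text \<open>
  The intermediate configuration exchanges the positions of the two points of \<open>s\<close>, which are
  adjacent up to an integer shift \<open>c\<close>.
\<close>

lemma cross_one:
  assumes "matching (crossed y z)" "s \<in> crossed y z"
  shows "\<exists>x. no_triple x \<and> crossed y x = {s} \<and> crossed x z = crossed y z - {s}"
proof -
  have s: "s \<in> pairs" and ne: "\<lfloor>gap s y\<rfloor> \<noteq> \<lfloor>gap s z\<rfloor>"
    using assms by (auto simp: crossed_def)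
  obtain k l where kl: "s = (k, l)" by fastforce
  have kl': "k \<in> {1..n}" "l \<in> {1..n}" "k < l" using s kl by (auto simp: pairs_def)
  obtain y' where y': "generic y'" "\<And>t. t \<in> pairs \<Longrightarrow> \<lfloor>gap t y'\<rfloor> = \<lfloor>gap t y\<rfloor>"
    using generic_exists by blast
  obtain z' where z': "generic z'" "\<And>t. t \<in> pairs \<Longrightarrow> \<lfloor>gap t z'\<rfloor> = \<lfloor>gap t z\<rfloor>"
    using generic_exists by blast
  define M N where "M = \<lfloor>y' k - y' l\<rfloor>" and "N = \<lfloor>z' k - z' l\<rfloor>"
  have MN: "M = \<lfloor>gap s y\<rfloor>" "N = \<lfloor>gap s z\<rfloor>"
    using y' z' s by (auto simp: M_def N_def kl gap_def)
  define c where "c = max M N"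
  have same: "\<lfloor>y' i - y' r\<rfloor> = \<lfloor>z' i - z' r\<rfloor>"
    if ir: "i = k \<or> i = l" "r \<in> {1..n}" "r \<noteq> k" "r \<noteq> l" for i r
  proof (rule generic_floor_eq)
    have "ord_pair i r \<notin> crossed y z"
      using assms ir kl kl' by (fastforce simp: matching_def disjoint_pairs_def ord_pair_def)
    then show "\<lfloor>gap (ord_pair i r) y'\<rfloor> = \<lfloor>gap (ord_pair i r) z'\<rfloor>"
      using y'(2)[of "ord_pair i r"] z'(2)[of "ord_pair i r"] ord_pair_in_pairs[of i r] ir kl'
      by (auto simp: crossed_def)
  qed (use y' z' ir kl' in auto)
  \<comment> \<open>The third point makes \<open>M\<close> and \<open>N\<close> consecutive, so the
    wall between them is at their maximum \<open>c\<close>. The formula in terms of \<open>r\<close>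
    is what preserves the floors relative to \<open>r\<close> when the two points trade
    places.\<close>
  have c: "c = \<lfloor>y' k - y' r\<rfloor> - \<lfloor>y' l - y' r\<rfloor> \<and> (M = c \<and> N = c - 1 \<or> M = c - 1 \<and> N = c)"
    if r: "r \<in> {1..n}" "r \<noteq> k" "r \<noteq> l" for r
    using same[OF _ r, of k] same[OF _ r, of l] ne floor_diff_cases[of "y' k" "y' l" "y' r"]
      floor_diff_cases[of "z' k" "z' l" "z' r"] MN
    unfolding c_def M_def[symmetric] N_def[symmetric] by auto
  have c': "M = c \<and> N = c - 1 \<or> M = c - 1 \<and> N = c"
    using third_index c by metis
  \<comment> \<open>The reflection of \<open>y'\<close> in the hyperplane where the difference of
    the coordinates \<open>k\<close> and \<open>l\<close> is \<open>c\<close>.\<close>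
  define x where "x = y'(k := y' l + c, l := y' k - c)"
  have xkl: "x k = y' l + c" "x l = y' k - c" "\<And>r. r \<noteq> k \<Longrightarrow> r \<noteq> l \<Longrightarrow> x r = y' r"
    using kl' by (auto simp: x_def)
  have nonint: "y' i - y' j \<notin> \<int>" if "i \<in> {1..n}" "j \<in> {1..n}" "i \<noteq> j" for i j
  proof (cases "i < j")
    case True
    then show ?thesis using y'(1) that unfolding generic_def by (force simp: pairs_def gap_def)
  next
    case False
    then have "(j, i) \<in> pairs" using that by (auto simp: pairs_def)
    then have "y' j - y' i \<notin> \<int>" using y'(1) unfolding generic_def by (force simp: gap_def)
    then show ?thesis using Ints_minus[of "y' i - y' j"] by auto
  qed
  have shift: "p + of_int m \<in> \<int> \<longleftrightarrow> p \<in> \<int>" for p :: real and m :: int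
    by (metis Ints_add Ints_diff Ints_of_int add_diff_cancel_right')
  have row: "\<lfloor>x i - x r\<rfloor> = \<lfloor>y' i - y' r\<rfloor> \<and> x i - x r \<notin> \<int>"
    if ir: "i = k \<or> i = l" "r \<in> {1..n}" "r \<noteq> k" "r \<noteq> l" for i r
    using ir(1)
  proof
    assume i: "i = k"
    have e: "x i - x r = (y' l - y' r) + of_int c" using i ir xkl by simp
    show ?thesis unfolding e shift using c[OF ir(2-4)] nonint[of l r] ir kl' by (simp add: i)
  next
    assume i: "i = l"
    have e: "x i - x r = (y' k - y' r) + of_int (- c)" using i ir xkl by simp
    show ?thesis unfolding e shift using c[OF ir(2-4)] nonint[of k r] ir kl' by (simp add: i)
  qed
  have e: "gap s x = (y' l - y' k) + of_int (2 * c)"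
    using xkl by (simp add: kl gap_def)
  have sx: "\<lfloor>gap s x\<rfloor> = N" "gap s x \<notin> \<int>"
    unfolding e shift floor_add_int[symmetric] using nonint[of l k] kl' c' floor_diff_sym[OF nonint[of k l]]
    by (auto simp: M_def[symmetric])
  have tx: "\<lfloor>gap t x\<rfloor> = \<lfloor>gap t y\<rfloor> \<and> gap t x \<notin> \<int>" if t: "t \<in> pairs" "t \<noteq> s" for t
  proof -
    obtain i j where ij: "t = (i, j)" by fastforce
    have ij': "i \<in> {1..n}" "j \<in> {1..n}" "i < j" using t ij by (auto simp: pairs_def)
    have "\<lfloor>x i - x j\<rfloor> = \<lfloor>y' i - y' j\<rfloor> \<and> x i - x j \<notin> \<int>"
    proof (cases "i = k \<or> i = l")
      case True
      then show ?thesis using row[of i j] ij' t kl ij kl' by auto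
    next
      case i: False
      show ?thesis
      proof (cases "j = k \<or> j = l")
        case True
        then have r: "\<lfloor>x j - x i\<rfloor> = \<lfloor>y' j - y' i\<rfloor>" "x j - x i \<notin> \<int>"
          using row[of j i] i ij' by auto
        have "\<lfloor>x i - x j\<rfloor> = \<lfloor>y' i - y' j\<rfloor>"
          using floor_diff_sym[OF r(2)] floor_diff_sym[OF nonint[of j i]] r ij' by simp
        then show ?thesis using r(2) Ints_minus[of "x i - x j"] by auto
      next
        case False
        then show ?thesis using i xkl nonint[of i j] ij' by auto
      qed
    qed
    then show ?thesis using y'(2)[OF t(1)] by (simp add: ij gap_def)
  qed
  have "generic x" using sx tx unfolding generic_def by metis
  then have "no_triple x" by (rule generic_no_triple)
  moreover have "t \<in> crossed y x \<longleftrightarrow> t = s" for t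
    using s sx(1) tx[of t] ne MN unfolding crossed_def by (cases "t = s") auto
  then have "crossed y x = {s}" by blast
  moreover have "t \<in> crossed x z \<longleftrightarrow> t \<in> crossed y z \<and> t \<noteq> s" for t
    using s sx(1) tx[of t] ne MN unfolding crossed_def by (cases "t = s") auto
  then have "crossed x z = crossed y z - {s}" by blast
  ultimately show ?thesis by blast
qed

end

section \<open>Galleries\<close>

context configurations begin

text \<open>Chains of adjacent chambers, as for Coxeter groups, with a path attached. The path is
  constrained only up to homotopy, so that moves on the word leave \<open>p\<close> unchanged. The
  empty word still allows a segment inside one chamber.\<close>

inductive gallery ::
    "(nat \<Rightarrow> real) \<Rightarrow> (nat \<times> nat) list \<Rightarrow> (nat \<Rightarrow> real) \<Rightarrow> (real \<Rightarrow> nat \<Rightarrow> complex) \<Rightarrow> bool" where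
  Nil: "\<lbrakk>no_triple y; no_triple z; crossed y z = {}; homotopic_paths Q p (emb \<circ> seg y z)\<rbrakk>
    \<Longrightarrow> gallery y [] z p"
| Cons: "\<lbrakk>no_triple y; crossed y x = {s}; gallery x w z q; homotopic_paths Q p ((emb \<circ> seg y x) +++ q)\<rbrakk>
    \<Longrightarrow> gallery y (s # w) z p"

lemma gallery_homotopic:
  assumes "gallery y w z p" "homotopic_paths Q q p"
  shows "gallery y w z q"
  using assms(1)
proof cases
  case Nil
  then show ?thesis using assms(2) homotopic_paths_trans gallery.Nil by blast
next
  case Cons
  then show ?thesis using assms(2) homotopic_paths_trans gallery.Cons by blast
qed

lemma gallery_no_triple: "gallery y w z p \<Longrightarrow> no_triple y" "gallery y w z p \<Longrightarrow> no_triple z"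
  by (induction rule: gallery.induct) auto

lemma gallery_path:
  assumes "gallery y w z p"
  shows "path p" "path_image p \<subseteq> Q" "pathstart p = emb y" "pathfinish p = emb z"
proof -
  have "path p \<and> path_image p \<subseteq> Q \<and> pathstart p = emb y \<and> pathfinish p = emb z"
    using assms
  proof (induction rule: gallery.induct)
    case (Nil y z p)
    then show ?case
      using homotopic_paths_imp_path homotopic_paths_imp_subset homotopic_paths_imp_pathstart
        homotopic_paths_imp_pathfinish by fastforce
  next
    case (Cons y x s w z q p)
    then show ?case
      using homotopic_paths_imp_path[OF Cons.hyps(4)] homotopic_paths_imp_subset[OF Cons.hyps(4)]
        homotopic_paths_imp_pathstart[OF Cons.hyps(4)] homotopic_paths_imp_pathfinish[OF Cons.hyps(4)] by auto
  qed
  then show "path p" "path_image p \<subseteq> Q" "pathstart p = emb y" "pathfinish p = emb z" by auto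
qed

lemma emb_seg_path:
  assumes "matching P" "y \<in> cell P a" "z \<in> cell P a"
  shows "path (emb \<circ> seg y z)" "path_image (emb \<circ> seg y z) \<subseteq> Q"
  using seg_in_cell[OF assms] by (auto intro!: path_emb path_image_emb simp: cell_def)

lemma crossed_trans: "crossed x z \<subseteq> crossed x y \<union> crossed y z"
  by (auto simp: crossed_def)

lemma crossed_cong: "crossed x y = {} \<Longrightarrow> crossed x z = crossed y z"
  unfolding crossed_def by auto

lemma crossed_in_pairs: "crossed x y \<subseteq> pairs"
  by (auto simp: crossed_def)

lemma matching_simps [simp]: "matching {}" "matching {s}"
  by (auto simp: matching_def)

text \<open>The new segment stays in the first chamber, so it lies in one cell with the first
  segment of the gallery and merges with it.\<close>

lemma gallery_shift:
  assumes "gallery y w z p" "no_triple x" "crossed x y = {}"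
  shows "gallery x w z ((emb \<circ> seg x y) +++ p)"
  using assms(1)
proof cases
  case Nil
  have c: "x \<in> cell {} x" "y \<in> cell {} x" "z \<in> cell {} x"
    using assms Nil crossed_cong[OF assms(3)] by (auto simp: cell_def crossed_def)
  have "homotopic_paths Q ((emb \<circ> seg x y) +++ p) ((emb \<circ> seg x y) +++ (emb \<circ> seg y z))"
    using emb_seg_path[OF _ c(1,2)] gallery_path[OF assms(1)] Nil by (intro homotopic_paths_join) auto
  also have "homotopic_paths Q \<dots> (emb \<circ> seg x z)"
    by (rule seg_join_homotopic[OF _ c]) simp
  finally show ?thesis
    unfolding Nil(1) using assms Nil crossed_cong[OF assms(3)] by (intro gallery.Nil) auto
next
  case (Cons x' s w' q)
  have x': "no_triple x'" using Cons gallery_no_triple by blast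
  have c: "x \<in> cell {s} x" "y \<in> cell {s} x" "x' \<in> cell {s} x"
    using assms Cons x' crossed_cong[OF assms(3), of x'] by (auto simp: cell_def crossed_def)
  note paths = emb_seg_path[OF matching_simps(2) c(1,2)] emb_seg_path[OF matching_simps(2) c(2,3)]
    gallery_path[OF assms(1)] gallery_path[OF Cons(4)]
  have "homotopic_paths Q ((emb \<circ> seg x y) +++ p) ((emb \<circ> seg x y) +++ ((emb \<circ> seg y x') +++ q))"
    using paths Cons by (intro homotopic_paths_join) auto
  also have "homotopic_paths Q \<dots> (((emb \<circ> seg x y) +++ (emb \<circ> seg y x')) +++ q)"
    using paths by (intro homotopic_paths_assoc) auto
  also have "homotopic_paths Q \<dots> ((emb \<circ> seg x x') +++ q)"
    using paths by (intro homotopic_paths_join seg_join_homotopic[OF _ c]) auto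
  finally show ?thesis
    unfolding Cons(1) using assms Cons crossed_cong[OF assms(3)] by (intro gallery.Cons) auto
qed

lemma gallery_append:
  assumes "gallery y w x p" "gallery x v z q"
  shows "gallery y (w @ v) z (p +++ q)"
  using assms
proof (induction rule: gallery.induct)
  case (Nil y x p)
  have "homotopic_paths Q (p +++ q) ((emb \<circ> seg y x) +++ q)"
    using Nil gallery_path[OF Nil(5)] homotopic_paths_imp_pathfinish[OF Nil(4)]
    by (intro homotopic_paths_join) auto
  then show ?case
    using gallery_homotopic[OF gallery_shift[OF Nil(5,1,3)]] by simp
next
  case (Cons y x' s w x r p)
  have IH: "gallery x' (w @ v) z (r +++ q)" using Cons by blast
  have "y \<in> cell {s} y" "x' \<in> cell {s} y"
    using Cons.hyps(1,2) gallery_no_triple(1)[OF IH] by (simp_all add: self_in_cell) (simp add: cell_def)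
  note paths = emb_seg_path[OF matching_simps(2) this] gallery_path[OF Cons(6)] gallery_path[OF Cons(3)]
  have "homotopic_paths Q (p +++ q) (((emb \<circ> seg y x') +++ r) +++ q)"
    using paths Cons homotopic_paths_imp_pathfinish[OF Cons.hyps(4)] by (intro homotopic_paths_join) auto
  also have "homotopic_paths Q \<dots> ((emb \<circ> seg y x') +++ (r +++ q))"
    using paths by (intro homotopic_paths_sym[OF homotopic_paths_assoc]) auto
  finally show ?case
    unfolding append_Cons by (rule gallery.Cons[OF Cons.hyps(1,2) IH])
qed

text \<open>The triangle \<open>y\<close>, \<open>x\<close>, \<open>x'\<close> lies in a cell of the
  matching \<open>P\<close>, so its third side replaces the other two. Commutation and cancellation
  both rest on this.\<close>

lemma gallery_cross:
  assumes "matching P" "crossed y x \<subseteq> P" "crossed x x' \<subseteq> P" "no_triple y" "no_triple x"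
    and "gallery x' w z q" "homotopic_paths Q r ((emb \<circ> seg x x') +++ q)"
  shows "homotopic_paths Q ((emb \<circ> seg y x) +++ r) ((emb \<circ> seg y x') +++ q)"
proof -
  have c: "y \<in> cell P y" "x \<in> cell P y" "x' \<in> cell P y"
    using assms crossed_trans[of y x' x] gallery_no_triple(1)[OF assms(6)]
    by (simp_all add: self_in_cell) (auto simp: cell_def)
  note paths = emb_seg_path[OF assms(1) c(1,2)] emb_seg_path[OF assms(1) c(2,3)] gallery_path[OF assms(6)]
  have "homotopic_paths Q ((emb \<circ> seg y x) +++ r) ((emb \<circ> seg y x) +++ ((emb \<circ> seg x x') +++ q))"
    using paths assms homotopic_paths_imp_pathstart[OF assms(7)] by (intro homotopic_paths_join) auto
  also have "homotopic_paths Q \<dots> (((emb \<circ> seg y x) +++ (emb \<circ> seg x x')) +++ q)"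
    using paths by (intro homotopic_paths_assoc) auto
  also have "homotopic_paths Q \<dots> ((emb \<circ> seg y x') +++ q)"
    using paths by (intro homotopic_paths_join seg_join_homotopic[OF assms(1) c]) auto
  finally show ?thesis .
qed

text \<open>Both orders of crossing are homotopic to the diagonal towards the configuration beyond
  both walls; \<open>cross_one\<close> supplies the missing corner of the square.\<close>

lemma gallery_swap:
  assumes "gallery y (s # t # w) z p" "disjoint_pairs s t"
  shows "gallery y (t # s # w) z p"
  using assms(1)
proof (cases rule: gallery.cases)
  case (Cons x q)
  note 1 = Cons
  from Cons(3) show ?thesis
  proof (cases rule: gallery.cases)
    case (Cons x' r)
    have st: "s \<noteq> t" using assms(2) by auto
    have cr: "crossed y x' = {s, t}"
    proof
      show "crossed y x' \<subseteq> {s, t}" using crossed_trans[of y x' x] 1 Cons by auto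
      have "s \<in> crossed y x" "t \<notin> crossed y x" "t \<in> crossed x x'" "s \<notin> crossed x x'"
        using 1(2) Cons(2) st by auto
      then show "{s, t} \<subseteq> crossed y x'" by (simp add: crossed_def)
    qed
    have m: "matching {s, t}"
      using assms(2) com_sym[OF assms(2)] by (auto simp: matching_def)
    obtain v where v: "no_triple v" "crossed y v = {t}" "crossed v x' = {s}"
      using cross_one[of y x' t] m st unfolding cr by auto
    have "homotopic_paths Q p ((emb \<circ> seg y x) +++ q)" by fact
    also have "homotopic_paths Q \<dots> ((emb \<circ> seg y x') +++ r)"
      using 1 Cons gallery_no_triple by (intro gallery_cross[OF m]) auto
    also have "homotopic_paths Q \<dots> ((emb \<circ> seg y v) +++ ((emb \<circ> seg v x') +++ r))"
    proof (rule homotopic_paths_sym, rule gallery_cross[OF m])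
      have c: "v \<in> cell {s, t} v" "x' \<in> cell {s, t} v"
        using v gallery_no_triple(1)[OF Cons(3)] by (simp_all add: self_in_cell) (simp add: cell_def)
      show "homotopic_paths Q ((emb \<circ> seg v x') +++ r) ((emb \<circ> seg v x') +++ r)"
        using emb_seg_path[OF m c] gallery_path[OF Cons(3)] by (auto simp: subset_path_image_join)
    qed (use 1 Cons v in auto)
    finally have "homotopic_paths Q p ((emb \<circ> seg y v) +++ ((emb \<circ> seg v x') +++ r))" .
    moreover have "gallery v (s # w) z ((emb \<circ> seg v x') +++ r)"
    proof (rule gallery.Cons[OF v(1,3) Cons(3)])
      have c: "v \<in> cell {s, t} v" "x' \<in> cell {s, t} v"
        using v gallery_no_triple(1)[OF Cons(3)] by (simp_all add: self_in_cell) (simp add: cell_def)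
      show "homotopic_paths Q ((emb \<circ> seg v x') +++ r) ((emb \<circ> seg v x') +++ r)"
        using emb_seg_path[OF m c] gallery_path[OF Cons(3)] by (auto simp: subset_path_image_join)
    qed
    ultimately show ?thesis using gallery.Cons[OF 1(1) v(2)] by blast
  qed
qed

text \<open>By \<open>crossed_twice\<close> the two crossings end in the chamber of
  \<open>y\<close>, so the segment replacing them crosses nothing and is absorbed by
  \<open>gallery_shift\<close>.\<close>

lemma gallery_cancel:
  assumes "gallery y (s # s # w) z p"
  shows "gallery y w z p"
  using assms
proof (cases rule: gallery.cases)
  case (Cons x q)
  note 1 = Cons
  from Cons(3) show ?thesis
  proof (cases rule: gallery.cases)
    case (Cons x' r)
    have "homotopic_paths Q p ((emb \<circ> seg y x) +++ q)" by fact
    also have "homotopic_paths Q \<dots> ((emb \<circ> seg y x') +++ r)"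
      using 1 Cons gallery_no_triple by (intro gallery_cross[of "{s}"]) auto
    finally show ?thesis
      using gallery_homotopic[OF gallery_shift[OF Cons(3) 1(1) crossed_twice[OF 1(2) Cons(2)]]] by blast
  qed
qed

text \<open>Swaps move the leading \<open>s\<close> next to its partner, and both disappear.\<close>

lemma gallery_can_cancel:
  assumes "gallery y (s # w) z p" "can_cancel s w"
  shows "\<exists>v. length v < length w \<and> gallery y v z p"
  using assms
proof (induction w arbitrary: y p)
  case (Cons t w)
  show ?case
  proof (cases "t = s")
    case True
    then show ?thesis using Cons.prems gallery_cancel by (intro exI[of _ w]) auto
  next
    case False
    then have st: "disjoint_pairs s t" "can_cancel s w" using Cons.prems by auto
    from gallery_swap[OF Cons.prems(1) st(1)] show ?thesis
    proof (cases rule: gallery.cases)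
      case (Cons x q)
      obtain v where "length v < length w" "gallery x v z q"
        using Cons.IH[OF Cons(3) st(2)] by blast
      then show ?thesis
        using gallery.Cons[OF Cons(1,2) _ Cons(4)] by (intro exI[of _ "t # v"]) auto
    qed
  qed
qed simp

lemma gallery_shorten:
  assumes "gallery y w z p" "\<not> reduced w"
  shows "\<exists>v. length v < length w \<and> gallery y v z p"
  using assms
proof (induction w arbitrary: y p)
  case (Cons s w)
  show ?case
  proof (cases "can_cancel s w")
    case True
    then obtain v where "length v < length w" "gallery y v z p"
      using gallery_can_cancel[OF Cons.prems(1)] by blast
    then show ?thesis by (intro exI[of _ v]) auto
  next
    case False
    with Cons.prems have "\<not> reduced w" by simp
    from Cons.prems(1) show ?thesis
    proof (cases rule: gallery.cases)
      case (Cons x q)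
      obtain v where "length v < length w" "gallery x v z q"
        using Cons.IH[OF Cons(3) \<open>\<not> reduced w\<close>] by blast
      then show ?thesis
        using gallery.Cons[OF Cons(1,2) _ Cons(4)] by (intro exI[of _ "s # v"]) auto
    qed
  qed
qed simp

text \<open>\<open>cross_one\<close> removes one pair of the matching at a time, and all
  intermediate configurations share a cell with the straight segment.\<close>

lemma gallery_seg:
  assumes "no_triple y" "no_triple z" "matching (crossed y z)"
  shows "\<exists>w. gallery y w z (emb \<circ> seg y z)"
  using assms
proof (induction "card (crossed y z)" arbitrary: y)
  case 0
  then have e: "crossed y z = {}" by simp
  have "path (emb \<circ> seg y z)" "path_image (emb \<circ> seg y z) \<subseteq> Q"
    by (rule emb_seg_path[of "{}" y y z]; use 0 e in \<open>simp add: cell_def crossed_def\<close>)+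
  then have "gallery y [] z (emb \<circ> seg y z)"
    using 0 e by (intro gallery.Nil) auto
  then show ?case by blast
next
  case (Suc m)
  from Suc.hyps(2) have "crossed y z \<noteq> {}" by auto
  then obtain s where s: "s \<in> crossed y z" by blast
  obtain x where x: "no_triple x" "crossed y x = {s}" "crossed x z = crossed y z - {s}"
    using cross_one[OF Suc.prems(3) s] by blast
  have "m = card (crossed x z)" using Suc.hyps(2) s by (simp add: x)
  moreover have "matching (crossed x z)"
    using matching_subset[OF Suc.prems(3)] x by auto
  ultimately obtain w where w: "gallery x w z (emb \<circ> seg x z)"
    using Suc.hyps(1) x(1) Suc.prems(2) by blast
  have c: "y \<in> cell (crossed y z) y" "x \<in> cell (crossed y z) y" "z \<in> cell (crossed y z) y"
    using Suc.prems x s by (simp_all add: self_in_cell) (simp_all add: cell_def)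
  have "gallery y (s # w) z (emb \<circ> seg y z)"
    by (rule gallery.Cons[OF Suc.prems(1) x(2) w homotopic_paths_sym[OF seg_join_homotopic[OF Suc.prems(3) c]]])
  then show ?case by blast
qed

text \<open>Two coinciding pairs with a common index would make three points coincide.\<close>

lemma matching_integral_gaps:
  assumes "no_triple y"
  shows "matching {s \<in> pairs. gap s y \<in> \<int>}"
  unfolding matching_def
proof (intro ballI impI)
  fix s t assume s: "s \<in> {s \<in> pairs. gap s y \<in> \<int>}" and t: "t \<in> {s \<in> pairs. gap s y \<in> \<int>}" and "s \<noteq> t"
  obtain i j k l where ij: "s = (i, j)" and kl: "t = (k, l)" by fastforce
  have o: "1 \<le> i" "i < j" "j \<le> n" "1 \<le> k" "k < l" "l \<le> n" "y i - y j \<in> \<int>" "y k - y l \<in> \<int>"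
    using s t by (auto simp: ij kl pairs_def gap_def)
  have n: "\<not> (y p - y q \<in> \<int> \<and> y q - y r \<in> \<int>)" if "1 \<le> p" "p < q" "q < r" "r \<le> n" for p q r
    using assms that by (auto simp: no_triple_def)
  show "disjoint_pairs s t"
  proof (rule ccontr)
    assume "\<not> disjoint_pairs s t"
    then consider "i = k" | "i = l" | "j = k" | "j = l"
      by (auto simp: disjoint_pairs_def ij kl)
    then show False
    proof cases
      case 1
      then have "j \<noteq> l" using \<open>s \<noteq> t\<close> by (auto simp: ij kl)
      moreover have "y j - y l \<in> \<int>" "y l - y j \<in> \<int>"
        using Ints_diff[OF o(8) o(7)] Ints_diff[OF o(7) o(8)] 1 by auto
      ultimately show False using n[of i j l] n[of i l j] o 1 by (cases "j < l") auto
    next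
      case 2
      then show False using n[of k l j] o by auto
    next
      case 3
      then show False using n[of i j l] o by auto
    next
      case 4
      then have "i \<noteq> k" using \<open>s \<noteq> t\<close> by (auto simp: ij kl)
      moreover have "y i - y k \<in> \<int>" "y k - y i \<in> \<int>"
        using Ints_diff[OF o(7) o(8)] Ints_diff[OF o(8) o(7)] 4 by auto
      ultimately show False using n[of i k j] n[of k i j] o 4 by (cases "i < k") auto
    qed
  qed
qed

lemma eventually_floor_eq:
  fixes f :: "'b \<Rightarrow> real"
  assumes "(f \<longlongrightarrow> p) F" "p \<notin> \<int>"
  shows "eventually (\<lambda>t. \<lfloor>f t\<rfloor> = \<lfloor>p\<rfloor>) F"
proof -
  have "p \<noteq> of_int \<lfloor>p\<rfloor>" using assms(2) by (metis Ints_of_int)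
  then have "of_int \<lfloor>p\<rfloor> < p" "p < of_int \<lfloor>p\<rfloor> + 1" by linarith+
  then have "eventually (\<lambda>t. of_int \<lfloor>p\<rfloor> < f t) F" "eventually (\<lambda>t. f t < of_int \<lfloor>p\<rfloor> + 1) F"
    using assms(1) order_tendstoD by blast+
  then show ?thesis
    by eventually_elim linarith
qed

text \<open>Near a given time only the gaps that are integral at that time can change their floors,
  and these form a matching. A short piece of the path, however often it crosses, thus stays in one
  convex cell and is homotopic to a segment.\<close>

lemma gallery_exists:
  assumes "path f" "\<And>t. t \<in> {0..1} \<Longrightarrow> no_triple (f t)"
  shows "\<exists>w. gallery (f 0) w (f 1) (emb \<circ> f)"
proof -
  \<comment> \<open>\<open>subpath\<close> acts on the identity of the interval, so that the
    homotopy joining two pieces takes place in \<open>{0..1}\<close> and is carried to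
    \<open>Q\<close> by \<open>emb \<circ> f\<close>.\<close>
  define g where "g u v = (emb \<circ> f) \<circ> subpath u v (\<lambda>x. x)" for u v :: real
  have cont: "continuous_on {0..1} (emb \<circ> f)"
    using path_emb[OF assms(1)] by (simp add: path_def)
  define R where "R u v \<longleftrightarrow> (0 \<le> u \<longrightarrow> v \<le> 1 \<longrightarrow> (\<exists>w. gallery (f u) w (f v) (g u v)))" for u v
  have "R 0 1" using zero_le_one
  proof (induction rule: Bolzano)
    case (trans r s t)
    show ?case unfolding R_def
    proof (intro impI)
      assume rt: "0 \<le> r" "t \<le> 1"
      obtain v w where "gallery (f r) v (f s) (g r s)" "gallery (f s) w (f t) (g s t)"
        using trans rt unfolding R_def by (meson order_trans)
      from gallery_append[OF this]
      have "gallery (f r) (v @ w) (f t) (g r s +++ g s t)" .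
      moreover have "homotopic_paths {0..1} (subpath r s (\<lambda>x. x) +++ subpath s t (\<lambda>x. x)) (subpath r t (\<lambda>x::real. x))"
        using rt trans by (intro homotopic_join_subpaths) (auto simp: path_def path_image_def)
      then have "homotopic_paths Q ((emb \<circ> f) \<circ> (subpath r s (\<lambda>x. x) +++ subpath s t (\<lambda>x. x))) (g r t)"
        unfolding g_def using assms(2)
        by (intro homotopic_paths_continuous_image[OF _ cont]) (auto simp: emb_in_Q_iff)
      ultimately show "\<exists>w. gallery (f r) w (f t) (g r t)"
        using gallery_homotopic homotopic_paths_sym unfolding g_def path_compose_join by blast
    qed
  next
    case (local x)
    define P where "P = {s \<in> pairs. gap s (f x) \<in> \<int>}"
    have nx: "no_triple (f x)" using assms(2) local by auto
    have P: "matching P" unfolding P_def by (rule matching_integral_gaps[OF nx])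
    have "((\<lambda>t. f t i) \<longlongrightarrow> f x i) (at x within {0..1})" for i
      using continuous_on_product_then_coordinatewise[of "{0..1}" f i] assms(1) local
      unfolding path_def continuous_on_def by auto
    then have "((\<lambda>t. gap s (f t)) \<longlongrightarrow> gap s (f x)) (at x within {0..1})" for s
      unfolding gap_def by (intro tendsto_intros)
    then have "eventually (\<lambda>t. \<forall>s\<in>pairs - P. \<lfloor>gap s (f t)\<rfloor> = \<lfloor>gap s (f x)\<rfloor>) (at x within {0..1})"
      by (intro eventually_ball_finite ballI eventually_floor_eq) (auto simp: P_def)
    then obtain d where d: "d > 0" "\<And>t. t \<in> {0..1} \<Longrightarrow> t \<noteq> x \<Longrightarrow> dist t x < d \<Longrightarrow> \<forall>s\<in>pairs - P. \<lfloor>gap s (f t)\<rfloor> = \<lfloor>gap s (f x)\<rfloor>"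
      unfolding eventually_at by blast
    have cell: "f t \<in> cell P (f x)" if "t \<in> {0..1}" "\<bar>t - x\<bar> < d" for t
    proof (cases "t = x")
      case True
      then show ?thesis using nx self_in_cell by auto
    next
      case False
      then show ?thesis
        using d(2)[OF that(1) False] that assms(2) unfolding cell_def crossed_def dist_real_def by force
    qed
    have "R u v" if uv: "u \<le> x" "x \<le> v" "v - u < d" for u v
      unfolding R_def
    proof (intro impI)
      assume b: "0 \<le> u" "v \<le> 1"
      have c: "f t \<in> cell P (f x)" if "u \<le> t" "t \<le> v" for t
        using that uv b by (intro cell) auto
      have "crossed (f u) (f v) \<subseteq> P"
        using c[of u] c[of v] uv crossed_trans[of "f u" "f v" "f x"] crossed_sym[of "f u" "f x"]
        by (auto simp: cell_def)
      then obtain w where w: "gallery (f u) w (f v) (emb \<circ> seg (f u) (f v))"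
        using gallery_seg matching_subset[OF P] assms(2) uv b by (meson atLeastAtMost_iff order_trans)
      have "homotopic_paths Q (emb \<circ> (f \<circ> subpath u v (\<lambda>x. x))) (emb \<circ> seg (f u) (f v))"
      proof (rule homotopic_emb[OF _ _ _ _ P])
        have uvt: "u \<le> subpath u v (\<lambda>x. x) t \<and> subpath u v (\<lambda>x. x) t \<le> v" if "t \<in> {0..1}" for t
        proof -
          have "0 \<le> (v - u) * t" "(v - u) * t \<le> (v - u) * 1"
            using that uv by (auto intro: mult_left_mono simp del: mult_1_right)
          then show ?thesis by (auto simp: subpath_def)
        qed
        have "continuous_on {0..1} (subpath u v (\<lambda>x::real. x))"
          unfolding subpath_def by (intro continuous_intros)
        moreover have "subpath u v (\<lambda>x. x) ` {0..1} \<subseteq> {0..1}"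
          using uvt b by fastforce
        ultimately show "path (f \<circ> subpath u v (\<lambda>x. x))"
          using assms(1) unfolding path_def by (blast intro: continuous_on_compose continuous_on_subset)
        show "(f \<circ> subpath u v (\<lambda>x. x)) t \<in> cell P (f x)" if "t \<in> {0..1}" for t
          using c uvt[OF that] by simp
      qed (use seg_in_cell[OF P c c] uv in \<open>auto simp: subpath_def\<close>)
      then show "\<exists>w. gallery (f u) w (f v) (g u v)"
        unfolding g_def comp_assoc
        using gallery_homotopic[OF w] by blast
    qed
    then show ?case using d(1) by blast
  qed
  moreover have "g 0 1 = emb \<circ> f"
    by (simp add: g_def subpath_def comp_def)
  ultimately show ?thesis by (simp add: R_def)
qed

end

section \<open>Holonomy of the round twin group\<close>

context configurations begin

text \<open>On the unit circle conjugation is inversion, so this is a quotient of coordinates: 1 at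
  a coincidence and -1 at antipodal positions.\<close>

definition coord_ratio :: "nat \<times> nat \<Rightarrow> (nat \<Rightarrow> complex) \<Rightarrow> complex" where
  "coord_ratio s x = (x(n := b)) (fst s) * cnj ((x(n := b)) (snd s))"

text \<open>
  The sign conditions on the real part exclude the passage through antipodal positions, where
  the imaginary part changes its sign as well. At coincident points the sign of the imaginary part
  is counted as positive, in accordance with the convention of \<open>\<lfloor>_\<rfloor>\<close> in \<open>crossed\<close>.
\<close>

definition jump :: "(nat \<Rightarrow> complex) \<Rightarrow> (nat \<Rightarrow> complex) \<Rightarrow> (nat \<times> nat) set" where
  "jump x y = {s \<in> pairs. 0 < Re (coord_ratio s x) \<and> 0 < Re (coord_ratio s y) \<and>
     (0 \<le> Im (coord_ratio s x)) \<noteq> (0 \<le> Im (coord_ratio s y))}"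

text \<open>An arbitrary order that turns a set of pairs into a word. Between nearby points of
  \<open>Q\<close> the jumping pairs commute and every order gives the same operator.\<close>

definition pair_list :: "(nat \<times> nat) list" where
  "pair_list = (SOME L. distinct L \<and> set L = pairs)"

lemma pair_list: "distinct pair_list" "set pair_list = pairs"
  using someI_ex[of "\<lambda>L. distinct L \<and> set L = pairs"] finite_distinct_list[OF finite_pairs]
  unfolding pair_list_def by blast+

definition crossing :: "(nat \<Rightarrow> complex) \<Rightarrow> (nat \<Rightarrow> complex) \<Rightarrow>
    ((nat \<times> nat) trace \<Rightarrow> bool) \<Rightarrow> (nat \<times> nat) trace \<Rightarrow> bool" where
  "crossing x y = act (filter (\<lambda>s. s \<in> jump x y) pair_list)"

lemma coord_ratio_emb: "s \<in> pairs \<Longrightarrow> coord_ratio s (emb y) = cis (2 * pi * gap s y)"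
proof -
  assume "s \<in> pairs"
  then have s: "fst s \<in> {1..n}" "snd s \<in> {1..n}" by (auto simp: pairs_def)
  have "coord_ratio s (emb y) = (b * cnj b) * (cis (2 * pi * (y (fst s) - y n)) * cnj (cis (2 * pi * (y (snd s) - y n))))"
    unfolding coord_ratio_def emb_upd[OF s(1)] emb_upd[OF s(2)] by simp
  also have "b * cnj b = 1" using norm_b by (simp flip: complex_norm_square)
  also have "cis (2 * pi * (y (fst s) - y n)) * cnj (cis (2 * pi * (y (snd s) - y n))) = cis (2 * pi * gap s y)"
    by (simp add: cis_cnj cis_mult gap_def algebra_simps)
  finally show ?thesis by simp
qed

lemma continuous_coord_ratio: "continuous_on X (coord_ratio s)"
proof -
  have c: "continuous_on X (\<lambda>x. x i)" for i :: nat and X :: "(nat \<Rightarrow> complex) set"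
    by (rule continuous_on_subset[OF continuous_on_product_coordinates]) simp
  show ?thesis
    unfolding coord_ratio_def
    by (cases "fst s = n"; cases "snd s = n") (auto intro!: continuous_intros c)
qed

lemma emb_surj:
  assumes "x \<in> torus n"
  shows "\<exists>y. x = emb y"
proof -
  define y where "y i = (if i = n then 0 else Arg (x i / b) / (2 * pi))" for i
  have "emb y i = x i" for i
  proof (cases "i \<in> {1..<n}")
    case True
    then have "norm (x i) = 1" using assms by (auto simp: torus_def PiE_iff)
    then have n1: "norm (x i / b) = 1" using norm_b by (simp add: norm_divide)
    then have "x i / b \<noteq> 0" by (metis norm_zero zero_neq_one)
    from cis_Arg[OF this] have "cis (Arg (x i / b)) = x i / b"
      unfolding sgn_div_norm n1 by simp
    moreover have "b \<noteq> 0" using norm_b by auto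
    ultimately show ?thesis using True by (simp add: emb_def y_def)
  next
    case False
    then show ?thesis using assms by (auto simp: emb_def torus_def PiE_iff extensional_def)
  qed
  then have "x = emb y" by auto
  then show ?thesis by blast
qed

lemma Q_subset_torus: "Q \<subseteq> torus n"
  by (auto simp: Q_space_def)

lemma cis_real_not_integer:
  assumes "d \<notin> \<int>" "sin (2 * pi * d) = 0"
  shows "cos (2 * pi * d) < 0"
proof (rule ccontr)
  assume c: "\<not> cos (2 * pi * d) < 0"
  have "(cos (2 * pi * d))\<^sup>2 = 1" using sin_cos_squared_add[of "2 * pi * d"] assms(2) by simp
  then have "cos (2 * pi * d) = 1" using c by (auto simp: power2_eq_1_iff)
  then have "cis (2 * pi * d) = cis (2 * pi * 0)" using assms(2) by (simp add: complex_eq_iff)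
  then show False using assms(1) unfolding cis_eq_iff by simp
qed

text \<open>For a pair that does not coincide at \<open>y\<close>, either the imaginary part of its
  ratio keeps a strict sign nearby or the real part stays negative, so it cannot jump. For a
  coinciding pair the real part stays positive and a jump is a plain change of sign; such changes
  add up modulo 2.\<close>

lemma jump_nhd:
  assumes "y \<in> Q"
  obtains U P where "open U" "y \<in> U" "matching P"
    "\<And>z w. z \<in> U \<Longrightarrow> w \<in> U \<Longrightarrow> jump z w = {s \<in> P. (0 \<le> Im (coord_ratio s z)) \<noteq> (0 \<le> Im (coord_ratio s w))}"
proof -
  obtain v where v: "y = emb v" using emb_surj assms Q_subset_torus by blast
  define P where "P = {s \<in> pairs. gap s v \<in> \<int>}"
  have "no_triple v" using assms v emb_in_Q_iff by simp
  then have P: "matching P" unfolding P_def by (rule matching_integral_gaps)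
  have op: "open {z. 0 < g (coord_ratio s z)}" if "continuous_on UNIV g" for s and g :: "complex \<Rightarrow> real"
    using continuous_on_compose2[OF that continuous_coord_ratio[of UNIV s]]
    by (intro open_Collect_less continuous_on_const) auto
  have ci: "continuous_on UNIV (\<lambda>z. Re z)" "continuous_on UNIV (\<lambda>z. - Re z)"
    "continuous_on UNIV (\<lambda>z. Im z)" "continuous_on UNIV (\<lambda>z. - Im z)"
    by (intro continuous_intros)+
  have "\<exists>U. open U \<and> y \<in> U \<and> (\<forall>z\<in>U. \<forall>w\<in>U. s \<in> jump z w \<longleftrightarrow>
      s \<in> P \<and> (0 \<le> Im (coord_ratio s z)) \<noteq> (0 \<le> Im (coord_ratio s w)))" if s: "s \<in> pairs" for s
  proof -
    have r: "coord_ratio s y = cis (2 * pi * gap s v)" using s by (simp add: v coord_ratio_emb)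
    show ?thesis
    proof (cases "s \<in> P")
      case True
      then have "coord_ratio s y = 1"
        using cis_eq_iff[of "gap s v" 0] r by (simp add: P_def)
      then show ?thesis
        using True s op[OF ci(1), of s] by (intro exI[of _ "{z. 0 < Re (coord_ratio s z)}"]) (auto simp: jump_def)
    next
      case False
      then have d: "gap s v \<notin> \<int>" using s by (auto simp: P_def)
      consider "0 < Im (coord_ratio s y)" | "0 < - Im (coord_ratio s y)" | "0 < - Re (coord_ratio s y)"
        using cis_real_not_integer[OF d] r by (cases "sin (2 * pi * gap s v) = 0") force+
      then show ?thesis
      proof cases
        case 1
        then show ?thesis
          using False op[OF ci(3), of s] by (intro exI[of _ "{z. 0 < Im (coord_ratio s z)}"]) (auto simp: jump_def)
      next
        case 2
        then show ?thesis
          using False op[OF ci(4), of s] by (intro exI[of _ "{z. 0 < - Im (coord_ratio s z)}"]) (auto simp: jump_def)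
      next
        case 3
        then show ?thesis
          using False op[OF ci(2), of s] by (intro exI[of _ "{z. 0 < - Re (coord_ratio s z)}"]) (auto simp: jump_def)
      qed
    qed
  qed
  then obtain U where U: "\<And>s. s \<in> pairs \<Longrightarrow> open (U s) \<and> y \<in> U s \<and> (\<forall>z\<in>U s. \<forall>w\<in>U s. s \<in> jump z w \<longleftrightarrow>
      s \<in> P \<and> (0 \<le> Im (coord_ratio s z)) \<noteq> (0 \<le> Im (coord_ratio s w)))"
    by metis
  have sub: "jump z w \<subseteq> pairs" "P \<subseteq> pairs" for z w
    by (auto simp: jump_def P_def)
  show ?thesis
  proof (rule that[of "\<Inter>s\<in>pairs. U s" P])
    show "open (\<Inter>s\<in>pairs. U s)" using U by (intro open_INT) auto
    show "jump z w = {s \<in> P. (0 \<le> Im (coord_ratio s z)) \<noteq> (0 \<le> Im (coord_ratio s w))}"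
      if zw: "z \<in> (\<Inter>s\<in>pairs. U s)" "w \<in> (\<Inter>s\<in>pairs. U s)" for z w
    proof (rule Set.set_eqI)
      fix s
      show "s \<in> jump z w \<longleftrightarrow> s \<in> {s \<in> P. (0 \<le> Im (coord_ratio s z)) \<noteq> (0 \<le> Im (coord_ratio s w))}"
      proof (cases "s \<in> pairs")
        case True
        then show ?thesis using U[OF True] zw by auto
      next
        case False
        then show ?thesis using sub by blast
      qed
    qed
  qed (use U P in auto)
qed

sublocale local_cocycle Q crossing
proof
  fix x assume "x \<in> Q"
  then obtain U P where U: "open U" "x \<in> U" "matching P"
    and jump: "\<And>z w. z \<in> U \<Longrightarrow> w \<in> U \<Longrightarrow> jump z w = {s \<in> P. (0 \<le> Im (coord_ratio s z)) \<noteq> (0 \<le> Im (coord_ratio s w))}"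
    using jump_nhd by blast
  have "crossing y y f = f" for y f
    by (simp add: crossing_def jump_def)
  moreover have "crossing z w (crossing y z f) = crossing y w f" if yzw: "y \<in> U" "z \<in> U" "w \<in> U" for y z w f
  proof -
    have "crossing z w (crossing y z f) =
        act (filter (\<lambda>s. (s \<in> jump z w) \<noteq> (s \<in> jump y z)) pair_list) f"
      unfolding crossing_def
      using U(3) jump[OF yzw(2,3)] jump[OF yzw(1,2)]
      by (intro act_filter_filter[where P = P] pair_list) (auto simp: matching_def)
    also have "(\<lambda>s. (s \<in> jump z w) \<noteq> (s \<in> jump y z)) = (\<lambda>s. s \<in> jump y w)"
      unfolding jump[OF yzw(2,3)] jump[OF yzw(1,2)] jump[OF yzw(1,3)] by auto
    finally show ?thesis by (simp add: crossing_def)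
  qed
  ultimately show "\<exists>U. open U \<and> x \<in> U \<and> (\<forall>y\<in>U \<inter> Q. \<forall>f. crossing y y f = f) \<and>
      (\<forall>y\<in>U \<inter> Q. \<forall>z\<in>U \<inter> Q. \<forall>w\<in>U \<inter> Q. \<forall>f. crossing z w (crossing y z f) = crossing y w f)"
    using U(1,2) by (intro exI[of _ U]) auto
qed

text \<open>The link between two descriptions of a crossing: signs of sine and cosine, which make
  sense on \<open>Q\<close>, and floors, which make sense on the lift. Both count a coincidence to
  the side of larger gap.\<close>

lemma eventually_jump_floor:
  fixes g :: "'b \<Rightarrow> real"
  assumes "(g \<longlongrightarrow> d) F"
  shows "eventually (\<lambda>t. (0 < cos (2 * pi * d) \<and> 0 < cos (2 * pi * g t) \<and>
      (0 \<le> sin (2 * pi * d)) \<noteq> (0 \<le> sin (2 * pi * g t))) \<longleftrightarrow> \<lfloor>d\<rfloor> \<noteq> \<lfloor>g t\<rfloor>) F"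
proof (cases "d \<in> \<int>")
  case True
  then obtain m where m: "d = of_int m" by (auto elim: Ints_cases)
  have per: "cis (2 * pi * p) = cis (2 * pi * (p - d))" for p
    using True by (simp add: cis_eq_iff)
  have d0: "cos (2 * pi * d) = 1" "sin (2 * pi * d) = 0"
    using per[of d] by (auto simp: complex_eq_iff)
  \<comment> \<open>Within a quarter turn of a coincidence the cosine is positive and the sine has
    the sign of the displacement.\<close>
  have "eventually (\<lambda>t. d - 1/4 < g t) F" "eventually (\<lambda>t. g t < d + 1/4) F"
    using assms by (auto intro!: order_tendstoD[where y = d])
  then show ?thesis
  proof eventually_elim
    case (elim t)
    define e where "e = g t - d"
    have e: "- (1/4) < e" "e < 1/4" using elim by (auto simp: e_def)
    have ce: "cos (2 * pi * g t) = cos (2 * pi * e)" "sin (2 * pi * g t) = sin (2 * pi * e)"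
      using per[of "g t"] by (auto simp: complex_eq_iff e_def)
    have r: "- (pi / 2) < 2 * pi * e" "2 * pi * e < pi / 2"
      using e mult_strict_left_mono[of "-(1/4)" e "2 * pi"] mult_strict_left_mono[of e "1/4" "2 * pi"] by auto
    then have "0 < cos (2 * pi * e)" by (intro cos_gt_zero_pi) auto
    moreover have "0 \<le> sin (2 * pi * e) \<longleftrightarrow> 0 \<le> e"
    proof (cases "0 \<le> e")
      case True
      then have "0 \<le> 2 * pi * e" by simp
      then show ?thesis using True r by (auto intro!: sin_ge_zero)
    next
      case False
      then have "2 * pi * e < 0" by (simp add: mult_pos_neg)
      then have "0 < sin (- (2 * pi * e))" using r by (intro sin_gt_zero) auto
      then show ?thesis using False by simp
    qed
    moreover have "\<lfloor>g t\<rfloor> = (if 0 \<le> e then m else m - 1)"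
      using e by (auto simp: floor_eq_iff e_def m)
    then have "\<lfloor>d\<rfloor> \<noteq> \<lfloor>g t\<rfloor> \<longleftrightarrow> \<not> 0 \<le> e"
      by (simp add: m)
    ultimately show ?case by (simp add: d0 ce)
  qed
next
  case False
  have fl: "eventually (\<lambda>t. \<lfloor>g t\<rfloor> = \<lfloor>d\<rfloor>) F"
    by (rule eventually_floor_eq[OF assms False])
  have sin: "((\<lambda>t. sin (2 * pi * g t)) \<longlongrightarrow> sin (2 * pi * d)) F"
    by (rule isCont_tendsto_compose[OF isCont_sin tendsto_mult_left[OF assms]])
  consider "sin (2 * pi * d) > 0" | "sin (2 * pi * d) < 0" | "cos (2 * pi * d) < 0"
    using cis_real_not_integer[OF False] by linarith
  then show ?thesis
  proof cases
    case 1
    show ?thesis using fl order_tendstoD(1)[OF sin 1] by eventually_elim (use 1 in auto)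
  next
    case 2
    show ?thesis using fl order_tendstoD(2)[OF sin 2] by eventually_elim (use 2 in auto)
  next
    case 3
    show ?thesis using fl by eventually_elim (use 3 in auto)
  qed
qed

lemma jump_emb:
  assumes "\<And>i. ((\<lambda>t. f t i) \<longlongrightarrow> y i) F"
  shows "eventually (\<lambda>t. jump (emb y) (emb (f t)) = crossed y (f t)) F"
proof -
  have "((\<lambda>t. gap s (f t)) \<longlongrightarrow> gap s y) F" for s
    unfolding gap_def by (intro tendsto_intros assms)
  then have "eventually (\<lambda>t. \<forall>s\<in>pairs. (0 < cos (2 * pi * gap s y) \<and> 0 < cos (2 * pi * gap s (f t)) \<and>
      (0 \<le> sin (2 * pi * gap s y)) \<noteq> (0 \<le> sin (2 * pi * gap s (f t)))) \<longleftrightarrow> \<lfloor>gap s y\<rfloor> \<noteq> \<lfloor>gap s (f t)\<rfloor>) F"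
    by (intro eventually_ball_finite finite_pairs ballI eventually_jump_floor)
  then show ?thesis
  proof eventually_elim
    case (elim t)
    have "s \<in> jump (emb y) (emb (f t)) \<longleftrightarrow> s \<in> crossed y (f t)" for s
    proof (cases "s \<in> pairs")
      case True
      then show ?thesis using elim[rule_format, OF True] by (simp add: jump_def crossed_def coord_ratio_emb)
    next
      case False
      then show ?thesis by (simp add: jump_def crossed_def)
    qed
    then show ?case by blast
  qed
qed

lemma par_seg:
  assumes "no_triple y" "no_triple z" "crossed y z \<subseteq> {s}" "s \<in> pairs"
  shows "par (emb \<circ> seg y z) f (if crossed y z = {} then f else gen_act s f)"
proof -
  \<comment> \<open>By \<open>crossed_twice\<close> at most two chambers occur along the segment,
    that of \<open>y\<close> and the one across the wall; the section takes one value on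
    each.\<close>
  define v where "v t = (if crossed y (seg y z t) = {} then f else gen_act s f)" for t
  have cell: "seg y z t \<in> cell {s} y" if "t \<in> {0..1}" for t
    using assms that by (intro seg_in_cell) (auto simp: cell_def crossed_def)
  have "transport (emb \<circ> seg y z) 0 1 v"
    unfolding transport_def
  proof
    fix t :: real assume t: "t \<in> {0..1}"
    have "((\<lambda>u. seg y z u i) \<longlongrightarrow> seg y z t i) (at t)" for i
      unfolding seg_def by (intro tendsto_intros)
    then have "eventually (\<lambda>u. jump (emb (seg y z t)) (emb (seg y z u)) = crossed (seg y z t) (seg y z u)) (at t)"
      by (rule jump_emb)
    then obtain d where d: "d > 0" "\<And>u. u \<noteq> t \<Longrightarrow> dist u t < d \<Longrightarrow>
        jump (emb (seg y z t)) (emb (seg y z u)) = crossed (seg y z t) (seg y z u)"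
      unfolding eventually_at by auto
    have "v u = crossing ((emb \<circ> seg y z) t) ((emb \<circ> seg y z) u) (v t)"
      if u: "u \<in> {0..1}" "\<bar>u - t\<bar> < d" for u
    proof (cases "u = t")
      case True
      then show ?thesis by (simp add: crossing_def jump_def)
    next
      case False
      define A where "A = crossed (seg y z t) (seg y z u)"
      have cr: "crossing ((emb \<circ> seg y z) t) ((emb \<circ> seg y z) u) = act (filter (\<lambda>s. s \<in> A) pair_list)"
        using d(2)[OF False] u by (simp add: crossing_def A_def dist_real_def)
      have yt: "crossed y (seg y z t) \<subseteq> {s}" and yu: "crossed y (seg y z u) \<subseteq> {s}"
        using cell[OF t] cell[OF u(1)] by (auto simp: cell_def)
      have "A \<subseteq> {s}"
        using crossed_trans[of "seg y z t" "seg y z u" y] yt yu crossed_sym[of "seg y z t" y]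
        by (auto simp: A_def)
      then consider "A = {}" | "A = {s}" by blast
      then show ?thesis
      proof cases
        case 1
        then have "crossed y (seg y z t) = crossed y (seg y z u)"
          using crossed_cong[of "seg y z t" "seg y z u" y] crossed_sym by (auto simp: A_def)
        then show ?thesis using 1 unfolding cr by (simp add: v_def)
      next
        case 2
        have a: "act (filter (\<lambda>s. s \<in> A) pair_list) g = gen_act s g" for g
          using act_filter_singleton[of pair_list s g] pair_list assms(4) by (simp add: 2)
        have "(crossed y (seg y z t) = {}) \<noteq> (crossed y (seg y z u) = {})"
        proof (cases "crossed y (seg y z t) = {}")
          case True
          then show ?thesis using crossed_cong[OF True, of "seg y z u"] 2 by (simp add: A_def)
        next
          case False
          then have "crossed y (seg y z t) = {s}" using yt by blast
          then show ?thesis using crossed_twice[of y "seg y z t" s "seg y z u"] 2 False by (simp add: A_def)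
        qed
        then show ?thesis unfolding cr a by (auto simp: v_def)
      qed
    qed
    then show "\<exists>d>0. \<forall>u\<in>{0..1}. \<bar>u - t\<bar> < d \<longrightarrow> v u = crossing ((emb \<circ> seg y z) t) ((emb \<circ> seg y z) u) (v t)"
      using d(1) by blast
  qed
  moreover have "crossed y y = {}" by (simp add: crossed_def)
  ultimately show ?thesis
    unfolding par_def by (intro exI[of _ v]) (simp add: v_def)
qed

lemma par_gallery: "gallery y w z p \<Longrightarrow> par p f (act w f)"
proof (induction arbitrary: f rule: gallery.induct)
  case (Nil y z p)
  \<comment> \<open>An arbitrary pair in the place of the one that may be crossed; the segment
    crosses none.\<close>
  have "(1, 2) \<in> pairs" using n3 by (auto simp: pairs_def)
  then have "par (emb \<circ> seg y z) f f"
    using par_seg[OF Nil(1,2), of "(1, 2)" f] Nil(3) by simp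
  then show ?case
    using par_homotopic[OF homotopic_paths_sym[OF Nil(4)]] by simp
next
  case (Cons y x s w z q p)
  have "s \<in> pairs" using Cons.hyps(2) crossed_in_pairs by blast
  then have "par (emb \<circ> seg y x) f (gen_act s f)"
    using par_seg[OF Cons.hyps(1) gallery_no_triple(1)[OF Cons.hyps(3)], of s f] Cons.hyps(2) by simp
  then have "par ((emb \<circ> seg y x) +++ q) f (act w (gen_act s f))"
    using Cons.IH gallery_path[OF Cons.hyps(3)] by (intro par_join) auto
  then show ?case
    using par_homotopic[OF homotopic_paths_sym[OF Cons.hyps(4)]] by simp
qed

text \<open>Each coordinate divided by \<open>b\<close> has a continuous logarithm on the interval,
  purely imaginary because the modulus is 1. The angle of index \<open>n\<close> is set to
  0.\<close>

lemma lift_exists: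
  assumes "path p" "path_image p \<subseteq> Q"
  obtains f where "path f" "\<And>t. t \<in> {0..1} \<Longrightarrow> p t = emb (f t)"
proof -
  have b0: "b \<noteq> 0" using norm_b by auto
  have pt: "p t \<in> torus n" if "t \<in> {0..1}" for t
    using assms(2) that Q_subset_torus unfolding path_image_def by blast
  have "\<exists>g. continuous_on {0..1} g \<and> (\<forall>t\<in>{0..1}. p t i / b = exp (g t))" if i: "i \<in> {1..<n}" for i
  proof -
    have "continuous_on {0..1} (\<lambda>t. p t i)"
      using assms(1) unfolding path_def by (rule continuous_on_product_then_coordinatewise)
    then have "continuous_on {0..1} (\<lambda>t. p t i / b)"
      using b0 by (intro continuous_intros) auto
    moreover have "p t i / b \<noteq> 0" if "t \<in> {0..1}" for t
    proof -
      have "norm (p t i) = 1" using pt[OF that] i by (auto simp: torus_def PiE_iff)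
      then show ?thesis using b0 by auto
    qed
    moreover have "contractible {0..1::real}" by (intro convex_imp_contractible convex_real_interval)
    ultimately obtain g where "continuous_on {0..1} g" "\<And>t. t \<in> {0..1} \<Longrightarrow> p t i / b = exp (g t)"
      using continuous_logarithm_on_contractible by blast
    then show ?thesis by blast
  qed
  then obtain g where g: "\<And>i. i \<in> {1..<n} \<Longrightarrow> continuous_on {0..1} (g i) \<and> (\<forall>t\<in>{0..1}. p t i / b = exp (g i t))"
    by metis
  define f where "f t i = (if i \<in> {1..<n} then Im (g i t) / (2 * pi) else 0)" for t :: real and i
  have "path f"
    unfolding path_def
  proof (rule continuous_on_coordinatewise_then_product)
    fix i
    show "continuous_on {0..1} (\<lambda>t. f t i)"
      using g[of i] unfolding f_def by (cases "i \<in> {1..<n}") (auto intro!: continuous_intros)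
  qed
  moreover have "p t = emb (f t)" if t: "t \<in> {0..1}" for t
  proof
    fix i
    show "p t i = emb (f t) i"
    proof (cases "i \<in> {1..<n}")
      case True
      have e: "p t i / b = exp (g i t)" using g[OF True] t by blast
      have "norm (p t i) = 1" using pt[OF t] True by (auto simp: torus_def PiE_iff)
      then have "norm (exp (g i t)) = 1" unfolding e[symmetric] using norm_b by (simp add: norm_divide)
      then have "Re (g i t) = 0" unfolding norm_exp_eq_Re by simp
      then have "exp (g i t) = cis (Im (g i t))"
        unfolding exp_eq_polar by simp
      then have "p t i = b * cis (Im (g i t))" using e b0 by (simp add: field_simps)
      then show ?thesis using True by (simp add: emb_def f_def)
    next
      case False
      then show ?thesis using pt[OF t] by (auto simp: emb_def torus_def PiE_iff extensional_def)
    qed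
  qed
  ultimately show ?thesis using that by blast
qed

text \<open>Relative to the \<open>n\<close>-th coordinate, \<open>y\<close> and \<open>z\<close>
  differ by integers, and equal floors make these less than 1 in modulus. So they differ by a common
  translation, which \<open>emb\<close> does not see, and the empty word between two lifts of the
  base point gives the constant loop.\<close>

lemma emb_seg_const:
  assumes "emb y = emb z" "crossed y z = {}"
  shows "emb (seg y z t) = emb y"
proof -
  have d: "y i - y n = z i - z n" if i: "i \<in> {1..<n}" for i
  proof -
    have "b * cis (2 * pi * (y i - y n)) = b * cis (2 * pi * (z i - z n))"
      using fun_cong[OF assms(1), of i] i by (simp add: emb_def)
    then have int: "(y i - y n) - (z i - z n) \<in> \<int>"
      using norm_b by (auto simp: cis_eq_iff)
    have "(i, n) \<in> pairs" using i by (auto simp: pairs_def)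
    then have "\<lfloor>y i - y n\<rfloor> = \<lfloor>z i - z n\<rfloor>" using assms(2) by (force simp: crossed_def gap_def)
    then have "\<bar>(y i - y n) - (z i - z n)\<bar> < 1" by linarith
    then show ?thesis using int by (auto elim!: Ints_cases simp flip: of_int_abs)
  qed
  have "seg y z t i - seg y z t n = y i - y n" if "i \<in> {1..<n}" for i
  proof -
    have "seg y z t i - seg y z t n = (1 - t) * (y i - y n) + t * (z i - z n)"
      by (simp add: seg_def algebra_simps)
    then show ?thesis unfolding d[OF that, symmetric] by (simp add: algebra_simps)
  qed
  then show ?thesis by (auto simp: emb_def)
qed

lemma trivial_holonomy_imp_null_homotopic:
  assumes "p \<in> loops_at Q x" "\<And>f k. f \<in> supp_below k \<Longrightarrow> par p f f"
  shows "homotopic_paths Q p (\<lambda>_. x)"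
proof -
  have p: "path p" "path_image p \<subseteq> Q" "p 0 = x" "p 1 = x"
    using assms(1) by (auto simp: loops_at_def pathstart_def pathfinish_def)
  obtain f where f: "path f" "\<And>t. t \<in> {0..1} \<Longrightarrow> p t = emb (f t)"
    using lift_exists[OF p(1,2)] by blast
  have nt: "no_triple (f t)" if "t \<in> {0..1}" for t
  proof -
    have "p t \<in> Q" using p(2) that unfolding path_image_def by blast
    then show ?thesis unfolding f(2)[OF that] emb_in_Q_iff .
  qed
  have hom: "homotopic_paths Q p (emb \<circ> f)"
    using f(2) by (intro homotopic_paths_eq p) auto
  obtain w0 where "gallery (f 0) w0 (f 1) (emb \<circ> f)"
    using gallery_exists[OF f(1) nt] by blast
  then have "\<exists>w. gallery (f 0) w (f 1) p"
    using gallery_homotopic[OF _ hom] by blast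
  \<comment> \<open>A word of least length takes the place of a terminating rewriting
    process.\<close>
  then obtain w where w: "gallery (f 0) w (f 1) p"
    and min: "\<And>v. gallery (f 0) v (f 1) p \<Longrightarrow> length w \<le> length v"
    using ex_has_least_nat[of "\<lambda>w. gallery (f 0) w (f 1) p" _ length] by blast
  have "reduced w"
    using gallery_shorten[OF w] min by (meson leD)
  moreover have "act w g = g" if "g \<in> supp_below k" for g k
    using par_unique[OF p(1,2) par_gallery[OF w, of g] assms(2)[OF that]] .
  ultimately have "w = []" by (rule reduced_act_trivial)
  with w have "gallery (f 0) [] (f 1) p" by simp
  then show ?thesis
  proof (cases rule: gallery.cases)
    case Nil
    have "emb (f 0) = x" "emb (f 1) = x" using f(2)[of 0] f(2)[of 1] p(3,4) by auto
    then have "emb \<circ> seg (f 0) (f 1) = (\<lambda>_. x)"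
      using emb_seg_const[of "f 0" "f 1"] Nil(3) by auto
    then show ?thesis using Nil(4) by simp
  qed
qed

lemma residually_nilpotent_round_twin_group:
  assumes "x \<in> Q"
  shows "residually_nilpotent (round_twin_group n b x)"
proof -
  \<comment> \<open>For the class of a loop there is exactly one such value, by uniqueness of
    transport and homotopy invariance.\<close>
  define hol where "hol X f = (SOME g. \<exists>p\<in>X. par p f g)" for X f
  have word: "\<exists>w. \<forall>f g. par p f g \<longleftrightarrow> g = act w f" if "p \<in> loops_at Q x" for p
  proof -
    \<comment> \<open>Word operators include all transition maps and are closed under composition,
      so one word describes the transport of every \<open>f\<close> along the loop.\<close>
    have "\<exists>A\<in>range act. \<forall>f g. par p f g \<longleftrightarrow> g = A f"
    proof (rule par_composite)
      fix A B :: "((nat \<times> nat) trace \<Rightarrow> bool) \<Rightarrow> (nat \<times> nat) trace \<Rightarrow> bool"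
      assume "A \<in> range act" "B \<in> range act"
      then obtain v w where AB: "A = act v" "B = act w" by blast
      have "B \<circ> A = act (v @ w)" by (rule ext) (simp add: AB)
      then show "B \<circ> A \<in> range act" by blast
    qed (use that in \<open>auto simp: loops_at_def crossing_def\<close>)
    then show ?thesis by blast
  qed
  have hol: "hol (path_class Q p) f = g" if p: "p \<in> loops_at Q x" and g: "par p f g" for p f g
  proof -
    have "(\<exists>q\<in>path_class Q p. par q f g') \<longleftrightarrow> g' = g" for g'
    proof
      assume "\<exists>q\<in>path_class Q p. par q f g'"
      then obtain q where "homotopic_paths Q p q" "par q f g'" by (auto simp: path_class_def)
      then have "par p f g'" using par_homotopic homotopic_paths_sym by blast
      then show "g' = g" using g par_unique[of p f g' g] p by (auto simp: loops_at_def)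
    next
      assume "g' = g"
      then show "\<exists>q\<in>path_class Q p. par q f g'" using path_class_self[OF p] g by blast
    qed
    then show ?thesis by (simp add: hol_def)
  qed
  let ?G = "fundamental_group Q x"
  have carrier: "\<exists>p\<in>loops_at Q x. X = path_class Q p" if "X \<in> carrier ?G" for X
    using that by (auto simp: fundamental_group_def)
  have total: "par p f (hol (path_class Q p) f)" if "p \<in> loops_at Q x" for p f
    using word[OF that] hol[OF that] by metis
  have "residually_nilpotent ?G"
  proof (rule residually_nilpotent_if_faithful_act[where hol = hol])
    show "group ?G" using assms by (rule group_fundamental_group)
    fix X assume "X \<in> carrier ?G"
    then obtain p where p: "p \<in> loops_at Q x" and X: "X = path_class Q p" using carrier by blast
    show "\<exists>w. hol X = act w"
      using word[OF p] hol[OF p] unfolding X by (metis ext)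
    show "hol (X \<otimes>\<^bsub>?G\<^esub> Y) = hol Y \<circ> hol X" if YG: "Y \<in> carrier ?G" for Y
    proof -
      obtain q where q: "q \<in> loops_at Q x" and Y: "Y = path_class Q q" using carrier[OF YG] by blast
      have "hol (path_class Q (p +++ q)) f = hol Y (hol X f)" for f
        using p q total by (intro hol loops_at_join par_join) (auto simp: X Y loops_at_def)
      then show ?thesis using p q by (auto simp: X Y fundamental_group_mult)
    qed
    show "X = \<one>\<^bsub>?G\<^esub>" if "\<And>f k. f \<in> supp_below k \<Longrightarrow> hol X f = f"
    proof -
      have "homotopic_paths Q p (\<lambda>_. x)"
      proof (rule trivial_holonomy_imp_null_homotopic[OF p])
        fix f k assume "f \<in> supp_below k"
        then have "hol (path_class Q p) f = f" using that by (simp add: X)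
        then show "par p f f" using total[OF p, of f] by simp
      qed
      then show ?thesis by (simp add: X fundamental_group_def path_class_eqI)
    qed
  qed
  then show ?thesis by (simp add: round_twin_group_def)
qed

end

theorem theorem16:
  fixes n :: nat and b :: complex and x :: "nat \<Rightarrow> complex"
  assumes "n \<ge> 1"
    and "b \<in> sphere 0 1"
    and "x \<in> Q_space n b"
  shows "residually_nilpotent (round_twin_group n b x)"
proof (cases "n \<le> 2")
  case True
  then show ?thesis
    using assms(3) by (intro residually_nilpotent_if_comm_group comm_group_round_twin_group)
next
  case False
  with assms(2) interpret configurations n b
    by unfold_locales auto
  show ?thesis
    using assms(3) by (rule residually_nilpotent_round_twin_group)
qed

end
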